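(* Let $n\geq 3$ and let $\Omega\subset\mathbb{R}^n$ be a bounded simple rotationally symmetric domain along the $x_n$ axis. Let $f\in C^1(\mathbb{R})$ be convex, and let $u$ be a positive stable solution of $$-\Delta u=f(u)\ \text{in}\ \Omega,\qquad u=0\ \text{on}\ \partial\Omega.$$ Then $u$ has a unique critical point in $\Omega$; this critical point is the maximum point of $u$, and it is non-degenerate.
   Context: A domain $\Omega$ is $x_i$-convex if for any two points $P,Q\in\Omega$ such that the segment $\overline{PQ}$ is parallel to the $x_i$ axis, one has $\overline{PQ}\subset\Omega$. A domain $\Omega\subset\mathbb{R}^n$ is simple rotationally symmetric along the $x_n$ axis if (1) it is symmetric with respect to the hyperplane $x_n=0$; (2) it is invariant under every orthogonal transformation $A\in O(n)$ fixing the $x_n$ axis; (3) it is $x_i$-convex for every $i=1,\dots,n$. A solution $u$ is stable if $\int_\Omega|\nabla\phi|^2dx-\int_\Omega f'(u)\phi^2dx>0$ for every nonzero $\phi\in H^1_0(\Omega)$; equivalently, the first Dirichlet eigenvalue of $-\Delta-f'(u)$ in $\Omega$ is positive. A critical point is non-degenerate if the Hessian of $u$ there has nonzero determinant. *)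

theory Defs
  imports "HOL-Analysis.Analysis"
begin

definition pd :: "'n::finite \<Rightarrow> (real^'n \<Rightarrow> real) \<Rightarrow> real^'n \<Rightarrow> real" where
  "pd i g x = frechet_derivative g (at x) (axis i 1)"

definition C2_on :: "(real^'n::finite) set \<Rightarrow> (real^'n \<Rightarrow> real) \<Rightarrow> bool" where
  "C2_on \<Omega> u \<longleftrightarrow> u differentiable_on \<Omega> \<and> (\<forall>i. pd i u differentiable_on \<Omega>)
     \<and> (\<forall>i j. continuous_on \<Omega> (pd j (pd i u)))"

definition laplacian :: "(real^'n::finite \<Rightarrow> real) \<Rightarrow> real^'n \<Rightarrow> real" where
  "laplacian u x = (\<Sum>i\<in>UNIV. pd i (pd i u) x)"

definition hessian :: "(real^'n::finite \<Rightarrow> real) \<Rightarrow> real^'n \<Rightarrow> real^'n^'n" where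
  "hessian u x = (\<chi> i j. pd j (pd i u) x)"

definition critical_point :: "(real^'n::finite \<Rightarrow> real) \<Rightarrow> real^'n \<Rightarrow> bool" where
  "critical_point u x \<longleftrightarrow> (\<forall>i. pd i u x = 0)"

definition domain :: "(real^'n::finite) set \<Rightarrow> bool" where
  "domain \<Omega> \<longleftrightarrow> open \<Omega> \<and> connected \<Omega> \<and> \<Omega> \<noteq> {}"

definition coord_convex :: "'n::finite \<Rightarrow> (real^'n) set \<Rightarrow> bool" where
  "coord_convex i \<Omega> \<longleftrightarrow> (\<forall>P\<in>\<Omega>. \<forall>Q\<in>\<Omega>. (\<forall>j. j \<noteq> i \<longrightarrow> P$j = Q$j) \<longrightarrow> closed_segment P Q \<subseteq> \<Omega>)"

definition simple_rot_sym :: "'n::finite \<Rightarrow> (real^'n) set \<Rightarrow> bool" where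
  "simple_rot_sym k \<Omega> \<longleftrightarrow>
     (\<forall>x\<in>\<Omega>. (\<chi> j. if j = k then - (x$j) else x$j) \<in> \<Omega>) \<and>
     (\<forall>A. orthogonal_transformation A \<and> (\<forall>t. A (t *\<^sub>R axis k 1) = t *\<^sub>R axis k 1) \<longrightarrow> A ` \<Omega> = \<Omega>) \<and>
     (\<forall>i. coord_convex i \<Omega>)"

text \<open>Compactly supported C^1 test functions in \<Omega> (dense in H^1_0(\<Omega>)).\<close>
definition test_fun :: "(real^'n::finite) set \<Rightarrow> (real^'n \<Rightarrow> real) \<Rightarrow> bool" where
  "test_fun \<Omega> \<phi> \<longleftrightarrow> \<phi> differentiable_on UNIV \<and> (\<forall>i. continuous_on UNIV (pd i \<phi>)) \<and>
     compact (closure {x. \<phi> x \<noteq> 0}) \<and> closure {x. \<phi> x \<noteq> 0} \<subseteq> \<Omega>"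

text \<open>Stability: the first Dirichlet eigenvalue of -\<Delta> - f'(u) is positive, i.e. the
  infimum of the Rayleigh quotient (over a dense subclass of H^1_0) is positive.\<close>
definition stable :: "(real^'n::finite) set \<Rightarrow> (real \<Rightarrow> real) \<Rightarrow> (real^'n \<Rightarrow> real) \<Rightarrow> bool" where
  "stable \<Omega> f' u \<longleftrightarrow> (\<exists>c>0. \<forall>\<phi>. test_fun \<Omega> \<phi> \<longrightarrow>
     integral \<Omega> (\<lambda>x. \<Sum>i\<in>UNIV. (pd i \<phi> x)^2) - integral \<Omega> (\<lambda>x. f' (u x) * (\<phi> x)^2)
       \<ge> c * integral \<Omega> (\<lambda>x. (\<phi> x)^2))"

end

theory Submission
  imports Defs
begin

text \<open>
  For a hyperplane \<open>x\<^sub>i = c\<close> with \<open>c \<ge> 0\<close>, reflect the cap \<open>{x\<^sub>i > c}\<close> of the domain into the domain. By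
  convexity of \<open>f\<close>, the difference \<open>w = u \<circ> refl - u\<close> satisfies \<open>- \<Delta> w \<ge> f'(u) w\<close> on the cap and \<open>w \<ge> 0\<close> on its
  boundary. Stability says exactly that the linearised operator obeys the maximum principle, so
  \<open>w \<ge> 0\<close> for every \<open>c\<close> at once. The case \<open>c = 0\<close> yields symmetry of \<open>u\<close> in each coordinate; for \<open>c > 0\<close> the
  strong maximum principle and Hopf's lemma give \<open>\<partial>\<^sub>i u < 0\<close> where \<open>x\<^sub>i > 0\<close>. Hence the origin is the only
  critical point. There the Hessian is diagonal by symmetry, and a Hopf estimate with a constant
  independent of \<open>c\<close>, divided by \<open>c \<rightarrow> 0\<close>, gives \<open>\<partial>\<^sub>i\<^sub>i u(0) < 0\<close>.
\<close>

section \<open>Partial derivatives and reflections\<close>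

text \<open>Three points shape the details. No regularity of the boundary is assumed, so there is no
  Green formula on a cap. It is replaced by the vanishing integral of a derivative of a compactly
  supported function, applied to \<open>cutoff_dual d z\<close> times the gradient of
  \<open>z\<close>. The positive part of \<open>z\<close> is not a C^1 test function with compact
  support either, so it is truncated at a level d > 0; this costs an error of order d, and the
  strictly positive constant in \<open>stable\<close> then forces the truncations to vanish as d
  tends to 0. Secondly, strict positivity of the reflected difference is produced and propagated
  along each ray parallel to the x_i axis separately, so that the topology of the whole cap never
  has to be analysed. Here c > 0 matters: the ray leaves the domain at a point whose mirror image is
  interior, whereas for c = 0 the difference vanishes identically. Thirdly, \<open>u\<close> is only
  assumed C^2, so \<open>pd i u\<close> cannot be inserted into a linearised equation classically;
  reflected differences take its place throughout.\<close>

lemma pd_eqI: "(g has_derivative D) (at x) \<Longrightarrow> pd i g x = D (axis i 1)"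
  unfolding pd_def using frechet_derivative_at by metis

lemma pd_cong:
  assumes "open S" "x \<in> S" "\<And>y. y \<in> S \<Longrightarrow> g y = h y"
  shows "pd i g x = pd i h x"
proof -
  have "(g has_derivative D) (at x) \<longleftrightarrow> (h has_derivative D) (at x)" for D
    using has_derivative_transform_within_open[of g D x UNIV S h]
      has_derivative_transform_within_open[of h D x UNIV S g] assms by auto
  then show ?thesis unfolding pd_def frechet_derivative_def by simp
qed

lemma pd_line:
  assumes "g differentiable (at (x + t *\<^sub>R axis i 1))"
  shows "((\<lambda>t. g (x + t *\<^sub>R axis i 1)) has_real_derivative pd i g (x + t *\<^sub>R axis i 1)) (at t)"
proof -
  let ?y = "x + t *\<^sub>R axis i 1"
  have g: "(g has_derivative frechet_derivative g (at ?y)) (at ?y)"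
    using assms frechet_derivative_works by blast
  have l: "((\<lambda>t. x + t *\<^sub>R axis i 1) has_derivative (\<lambda>h. h *\<^sub>R axis i 1)) (at t)"
    by (auto intro!: derivative_eq_intros)
  have "((\<lambda>t. g (x + t *\<^sub>R axis i 1)) has_derivative
      (\<lambda>h. frechet_derivative g (at ?y) (h *\<^sub>R axis i 1))) (at t)"
    using has_derivative_compose[OF l g] .
  moreover have "(\<lambda>h. frechet_derivative g (at ?y) (h *\<^sub>R axis i 1)) = (*) (pd i g ?y)"
    unfolding pd_def using linear_frechet_derivative[OF assms] by (auto simp: linear_scale mult.commute)
  ultimately show ?thesis unfolding has_field_derivative_def by simp
qed

lemma pd_const [simp]: "pd i (\<lambda>x. c) x = 0"
  by (rule pd_eqI) (auto intro!: derivative_eq_intros)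

lemma pd_diff:
  assumes "g differentiable (at x)" "h differentiable (at x)"
  shows "pd i (\<lambda>x. g x - h x) x = pd i g x - pd i h x"
proof -
  note d = assms[unfolded frechet_derivative_works]
  show ?thesis using pd_eqI[OF has_derivative_diff[OF d]] unfolding pd_def .
qed

lemma pd_mult:
  assumes "g differentiable (at x)" "h differentiable (at x)"
  shows "pd i (\<lambda>x. g x * h x) x = g x * pd i h x + pd i g x * h x"
proof -
  note d = assms[unfolded frechet_derivative_works]
  show ?thesis using pd_eqI[OF has_derivative_mult[OF d]] unfolding pd_def .
qed

lemma pd_cmult:
  assumes "h differentiable (at x)"
  shows "pd i (\<lambda>x. c * h x) x = c * pd i h x"
  using pd_mult[of "\<lambda>x. c" x h i] assms by simp

lemma pd_chain:
  assumes "(G has_real_derivative d) (at (z x))" "z differentiable (at x)"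
  shows "pd i (\<lambda>x. G (z x)) x = d * pd i z x" "(\<lambda>x. G (z x)) differentiable (at x)"
proof -
  have "((\<lambda>x. G (z x)) has_derivative (\<lambda>v. frechet_derivative z (at x) v * d)) (at x)"
    using has_derivative_compose[OF assms(2)[unfolded frechet_derivative_works]
      assms(1)[unfolded has_field_derivative_def]] by (simp add: mult.commute)
  from pd_eqI[OF this] differentiableI[OF this]
  show "pd i (\<lambda>x. G (z x)) x = d * pd i z x" "(\<lambda>x. G (z x)) differentiable (at x)"
    unfolding pd_def by auto
qed

lemma C2_onD:
  assumes "C2_on D u" "open D"
  shows "x \<in> D \<Longrightarrow> u differentiable (at x)" "x \<in> D \<Longrightarrow> pd i u differentiable (at x)"
    "continuous_on D u" "continuous_on D (pd i u)" "continuous_on D (pd j (pd i u))"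
  using assms unfolding C2_on_def differentiable_on_eq_differentiable_at[OF assms(2)]
  by (auto intro!: continuous_at_imp_continuous_on differentiable_imp_continuous_within)

lemma C2_onI:
  assumes "open D" "\<And>x. x \<in> D \<Longrightarrow> u differentiable (at x)"
    "\<And>x i. x \<in> D \<Longrightarrow> pd i u differentiable (at x)"
    "\<And>i j. continuous_on D (pd j (pd i u))"
  shows "C2_on D u"
  using assms unfolding C2_on_def differentiable_on_eq_differentiable_at[OF assms(1)] by simp

lemma C2_on_subset: "C2_on D u \<Longrightarrow> E \<subseteq> D \<Longrightarrow> C2_on E u"
  unfolding C2_on_def by (meson continuous_on_subset differentiable_on_subset)

lemma differentiable_cong_open:
  assumes "open S" "x \<in> S" "\<And>y. y \<in> S \<Longrightarrow> g y = h y" "h differentiable (at x)"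
  shows "g differentiable (at x)"
proof -
  obtain h' where "(h has_derivative h') (at x)" using assms(4) unfolding differentiable_def by blast
  then have "(g has_derivative h') (at x)"
    by (rule has_derivative_transform_within_open[OF _ assms(1,2)]) (use assms(3) in simp)
  then show ?thesis by (rule differentiableI)
qed

lemma C2_on_diff:
  assumes "open D" "C2_on D g" "C2_on D h"
  shows "C2_on D (\<lambda>x. g x - h x)"
    and "x \<in> D \<Longrightarrow> laplacian (\<lambda>x. g x - h x) x = laplacian g x - laplacian h x"
proof -
  note G = C2_onD[OF assms(2,1)] and H = C2_onD[OF assms(3,1)]
  have 1: "pd i (\<lambda>x. g x - h x) x = pd i g x - pd i h x" if "x \<in> D" for i x
    using pd_diff G(1) H(1) that by blast
  have 2: "pd j (pd i (\<lambda>x. g x - h x)) x = pd j (pd i g) x - pd j (pd i h) x" if "x \<in> D" for i j x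
  proof -
    have "pd j (pd i (\<lambda>x. g x - h x)) x = pd j (\<lambda>x. pd i g x - pd i h x) x"
      by (rule pd_cong[OF assms(1) that 1])
    then show ?thesis using pd_diff[OF G(2) H(2)] that by simp
  qed
  show "C2_on D (\<lambda>x. g x - h x)"
  proof (rule C2_onI[OF assms(1)])
    show "pd i (\<lambda>x. g x - h x) differentiable at x" if "x \<in> D" for i x
      by (rule differentiable_cong_open[OF assms(1) that 1]) (assumption, intro differentiable_diff G(2) H(2) that)
    show "continuous_on D (pd j (pd i (\<lambda>x. g x - h x)))" for i j
      by (subst continuous_on_cong[OF HOL.refl 2], assumption) (intro continuous_intros G(5) H(5))
  qed (intro differentiable_diff G(1) H(1))
  show "x \<in> D \<Longrightarrow> laplacian (\<lambda>x. g x - h x) x = laplacian g x - laplacian h x"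
    by (simp add: laplacian_def 2 sum_subtractf)
qed

section \<open>Reflections in hyperplanes orthogonal to a coordinate axis\<close>

definition refl_at :: "'n::finite \<Rightarrow> real \<Rightarrow> real^'n \<Rightarrow> real^'n" where
  "refl_at i c x = x + (2 * c - 2 * x$i) *\<^sub>R axis i 1"

lemma refl_at_nth [simp]: "refl_at i c x $ j = (if j = i then 2 * c - x$i else x$j)"
  by (simp add: refl_at_def axis_def)

lemma refl_at_idem [simp]: "refl_at i c (refl_at i c x) = x"
  by (simp add: vec_eq_iff)

lemma continuous_refl_at [continuous_intros]:
  "continuous_on S g \<Longrightarrow> continuous_on S (\<lambda>x. refl_at i c (g x))"
  unfolding refl_at_def by (intro continuous_intros)

lemma open_refl_at_vimage: "open S \<Longrightarrow> open (refl_at i c -` S)"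
  by (rule open_vimage) (auto intro!: continuous_intros)

lemma pd_refl_at:
  assumes "g differentiable (at (refl_at i c x))"
  shows "pd j (\<lambda>x. g (refl_at i c x)) x = (if j = i then -1 else 1) * pd j g (refl_at i c x)"
    and "(\<lambda>x. g (refl_at i c x)) differentiable (at x)"
proof -
  let ?D = "frechet_derivative g (at (refl_at i c x))"
  have r: "(refl_at i c has_derivative (\<lambda>h. h - (2 * h$i) *\<^sub>R axis i 1)) (at x)"
    unfolding refl_at_def
    by (rule derivative_eq_intros bounded_linear_imp_has_derivative[OF bounded_linear_vec_nth] HOL.refl)+
      (simp add: algebra_simps)
  have d: "((\<lambda>x. g (refl_at i c x)) has_derivative (\<lambda>h. ?D (h - (2 * h$i) *\<^sub>R axis i 1))) (at x)"
    using has_derivative_compose[OF r] assms frechet_derivative_works by blast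
  have "axis j 1 - (2 * (axis j 1 :: real^'a) $ i) *\<^sub>R axis i 1
      = (if j = i then -1 else 1) *\<^sub>R (axis j 1 :: real^'a)"
    by (auto simp: axis_def vec_eq_iff)
  then show "pd j (\<lambda>x. g (refl_at i c x)) x = (if j = i then -1 else 1) * pd j g (refl_at i c x)"
    unfolding pd_eqI[OF d] unfolding pd_def
    using linear_scale[OF linear_frechet_derivative[OF assms]] linear_neg[OF linear_frechet_derivative[OF assms]] by auto
  show "(\<lambda>x. g (refl_at i c x)) differentiable (at x)" using d by (rule differentiableI)
qed

text \<open>Every derivative in direction i picks up a factor -1. The Laplacian contains only
  repeated derivatives, where this factor occurs twice and cancels.\<close>

lemma C2_on_refl_at:
  assumes "open D" "C2_on D u"
  shows "C2_on (refl_at i c -` D) (\<lambda>x. u (refl_at i c x))"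
    and "refl_at i c x \<in> D \<Longrightarrow> laplacian (\<lambda>x. u (refl_at i c x)) x = laplacian u (refl_at i c x)"
proof -
  note U = C2_onD[OF assms(2,1)]
  define s :: "'a \<Rightarrow> real" where "s j = (if j = i then -1 else 1)" for j
  have s2: "s j * s j = 1" for j by (simp add: s_def)
  let ?E = "refl_at i c -` D" and ?v = "\<lambda>x. u (refl_at i c x)"
  have oE: "open ?E" using assms(1) by (rule open_refl_at_vimage)
  have 1: "pd j ?v x = s j * pd j u (refl_at i c x)" if "x \<in> ?E" for x j
    using pd_refl_at(1)[OF U(1)] that by (auto simp: s_def)
  have 2: "pd l (pd j ?v) x = s j * s l * pd l (pd j u) (refl_at i c x)" if "x \<in> ?E" for x j l
  proof -
    have "pd l (pd j ?v) x = pd l (\<lambda>x. s j * pd j u (refl_at i c x)) x"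
      by (rule pd_cong[OF oE that 1])
    also have "\<dots> = s j * (s l * pd l (pd j u) (refl_at i c x))"
      using that U(2) by (subst pd_cmult) (auto intro!: pd_refl_at(2) simp: s_def pd_refl_at(1))
    finally show ?thesis by simp
  qed
  show "C2_on ?E ?v"
  proof (rule C2_onI[OF oE])
    show "?v differentiable at x" if "x \<in> ?E" for x
      using pd_refl_at(2)[OF U(1)] that by auto
    show "pd j ?v differentiable at x" if "x \<in> ?E" for j x
      by (rule differentiable_cong_open[OF oE that 1])
        (use that in \<open>auto intro!: differentiable_mult pd_refl_at(2) U(2)\<close>)
    show "continuous_on ?E (pd l (pd j ?v))" for l j
      by (subst continuous_on_cong[OF HOL.refl 2], assumption)
        (auto intro!: continuous_intros continuous_on_compose2[OF U(5)])
  qed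
  show "refl_at i c x \<in> D \<Longrightarrow> laplacian ?v x = laplacian u (refl_at i c x)"
    by (simp add: laplacian_def 2 s2)
qed

section \<open>Integration of compactly supported functions\<close>

definition zero_ext :: "'a set \<Rightarrow> ('a \<Rightarrow> real) \<Rightarrow> 'a \<Rightarrow> real" where
  "zero_ext D h x = (if x \<in> D then h x else 0)"

text \<open>\<open>D\<close> and the complement of \<open>S\<close> are open and cover the space; on
  the first the extension is \<open>h\<close>, on the second it is 0. Derivatives are local, so each
  point needs only one of the two.\<close>

lemma zero_ext_pd:
  fixes h :: "real^'n::finite \<Rightarrow> real"
  assumes "open D" "closed S" "S \<subseteq> D" "\<And>x. x \<in> D \<Longrightarrow> x \<notin> S \<Longrightarrow> h x = 0"
    "\<And>x. x \<in> D \<Longrightarrow> h differentiable (at x)"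
  shows "zero_ext D h differentiable (at x)" "pd i (zero_ext D h) = zero_ext D (pd i h)"
proof -
  have eD: "zero_ext D h y = h y" if "y \<in> D" for y using that by (simp add: zero_ext_def)
  have eS: "zero_ext D h y = 0" if "y \<in> - S" for y using that assms(3,4) by (auto simp: zero_ext_def)
  have oS: "open (- S)" using assms(2) by (rule open_Compl)
  have pD: "pd i (zero_ext D h) y = pd i h y" if "y \<in> D" for y
    by (rule pd_cong[OF assms(1) that eD])
  have pS: "pd i (zero_ext D h) y = 0" if "y \<in> - S" for y
    using pd_cong[OF oS that eS] by simp
  show "zero_ext D h differentiable (at x)"
  proof (cases "x \<in> D")
    case True
    show ?thesis by (rule differentiable_cong_open[OF assms(1) True eD assms(5)[OF True]])
  next
    case False
    then have "x \<in> - S" using assms(3) by auto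
    from differentiable_cong_open[OF oS this eS] show ?thesis by simp
  qed
  show "pd i (zero_ext D h) = zero_ext D (pd i h)"
  proof
    show "pd i (zero_ext D h) y = zero_ext D (pd i h) y" for y
      using pD[of y] pS[of y] assms(3) by (auto simp: zero_ext_def)
  qed
qed

lemma zero_ext_continuous:
  fixes h :: "'a::topological_space \<Rightarrow> real"
  assumes "open D" "closed S" "S \<subseteq> D" "\<And>x. x \<in> D \<Longrightarrow> x \<notin> S \<Longrightarrow> h x = 0" "continuous_on D h"
  shows "continuous_on UNIV (zero_ext D h)"
proof -
  have "continuous_on (D \<union> - S) (zero_ext D h)"
  proof (rule continuous_on_open_Un)
    show "continuous_on D (zero_ext D h)"
      using assms(5) by (subst continuous_on_cong[of D D _ h]) (auto simp: zero_ext_def)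
    show "continuous_on (- S) (zero_ext D h)"
      using assms(3,4) by (subst continuous_on_cong[of "-S" "-S" _ "\<lambda>x. 0"]) (auto simp: zero_ext_def)
  qed (use assms in auto)
  moreover have "D \<union> - S = UNIV" using assms(3) by auto
  ultimately show ?thesis by simp
qed

lemma integral_continuous_compact_support:
  fixes h :: "'a::euclidean_space \<Rightarrow> real"
  assumes "continuous_on UNIV h" "bounded S" "\<And>x. x \<notin> S \<Longrightarrow> h x = 0" "S \<subseteq> D"
  shows "h integrable_on D" "integral D h = integral UNIV h"
proof -
  obtain a where a: "S \<subseteq> cbox (- a) a" using bounded_subset_cbox_symmetric[OF assms(2)] .
  have "h integrable_on cbox (- a) a"
    by (rule integrable_continuous) (use assms(1) continuous_on_subset in blast)
  then obtain I where "(h has_integral I) (cbox (- a) a)" by blast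
  then have I: "(h has_integral I) UNIV"
    by (rule has_integral_on_superset) (use assms(3) a in auto)
  then have "((\<lambda>x. if x \<in> D then h x else 0) has_integral I) UNIV"
    by (rule has_integral_eq[rotated]) (use assms(3,4) in auto)
  then have "(h has_integral I) D" by (simp only: has_integral_restrict_UNIV)
  with I show "h integrable_on D" "integral D h = integral UNIV h"
    by (auto simp: integral_unique)
qed

text \<open>Translation invariance gives \<open>\<integral> (F(x + t e) - F x) / t dx = 0\<close>; let \<open>t \<rightarrow> 0\<close>.\<close>
lemma integral_pd_eq_0:
  fixes F :: "real^'n::finite \<Rightarrow> real"
  assumes diff: "\<And>x. F differentiable (at x)" and cont: "continuous_on UNIV (pd i F)"
    and S: "bounded S" "\<And>x. x \<notin> S \<Longrightarrow> F x = 0"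
  shows "integral UNIV (pd i F) = 0"
proof -
  define e :: "real^'n" where "e = axis i 1"
  obtain R where R: "\<And>x. x \<in> S \<Longrightarrow> norm x \<le> R" using S(1) unfolding bounded_iff by blast
  \<comment> \<open>The margin 1 covers the shifts \<open>t k\<close> <= 1: outside the box both
    \<open>F\<close> and its shifts vanish, so shifting does not change the integral over the
    box.\<close>
  obtain a :: "real^'n" where a: "cball 0 (R + 1) \<subseteq> cbox (- a) a"
    using bounded_subset_cbox_symmetric[OF bounded_cball] .
  have z: "F x = 0" if "norm x > R" for x using S(2) R that by force
  have opz: "open {x::real^'n. norm x > R}" by (intro open_Collect_less continuous_intros)
  have pz: "pd i F x = 0" if "norm x > R" for x
    using pd_cong[OF opz, of x F "\<lambda>x. 0" i] z that by simp
  have cF: "continuous_on UNIV F"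
    using diff by (auto intro!: continuous_at_imp_continuous_on differentiable_imp_continuous_within)
  have nx: "norm x > R" if "x \<notin> cbox (- a) a" for x using a that by (force simp: dist_norm)
  have ns: "norm (x + t *\<^sub>R e) > R" if "x \<notin> cbox (- a) a" "\<bar>t\<bar> \<le> 1" for x :: "real^'n" and t
  proof -
    have "norm x > R + 1" using a that by (force simp: dist_norm)
    moreover have "norm x \<le> norm (x + t *\<^sub>R e) + norm (t *\<^sub>R e)"
      using norm_triangle_ineq4[of "x + t *\<^sub>R e" "t *\<^sub>R e"] by simp
    ultimately show ?thesis using that(2) by (simp add: e_def)
  qed
  define t where "t k = 1 / (real k + 1)" for k
  have t: "t k > 0" "\<bar>t k\<bar> \<le> 1" for k by (auto simp: t_def)
  have t0: "t \<longlonglongrightarrow> 0" unfolding t_def using LIMSEQ_inverse_real_of_nat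
    by (simp add: inverse_eq_divide add.commute)
  define g where "g k x = (F (x + t k *\<^sub>R e) - F x) / t k" for k x
  have cs: "continuous_on UNIV (\<lambda>x. F (x + t k *\<^sub>R e))" for k
    by (intro continuous_on_compose2[OF cF] continuous_intros) auto
  have cg: "continuous_on UNIV (g k)" for k
    unfolding g_def using t(1)[of k] by (intro continuous_intros cs cF) auto
  have sup: "integral (cbox (- a) a) h = integral UNIV h"
    if "continuous_on UNIV h" "\<And>x. x \<notin> cbox (- a) a \<Longrightarrow> h x = 0" for h :: "real^'n \<Rightarrow> real"
    using integral_continuous_compact_support(2)[OF that(1) bounded_cbox that(2)] by blast
  have ig: "integral (cbox (- a) a) (g k) = 0" for k
  proof -
    let ?s = "t k *\<^sub>R e"
    have sh: "integral (cbox (- a) a) (\<lambda>x. F (x + ?s)) = integral (cbox (- a + ?s) (a + ?s)) F"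
      using integral_shift_cbox_plus[of "-a" a F ?s] by (simp add: o_def add.commute)
    have "F x = 0" if "x \<notin> cbox (- a + ?s) (a + ?s)" for x
    proof -
      have "x - ?s \<notin> cbox (- a) a"
        using that cbox_translation[of ?s "-a" a] by (auto simp: add.commute image_iff)
      from ns[OF this t(2)[of k]] show ?thesis using z by simp
    qed
    then have "integral (cbox (- a + ?s) (a + ?s)) F = integral UNIV F"
      using integral_continuous_compact_support(2)[OF cF bounded_cbox _ order_refl] by blast
    moreover have "integral (cbox (- a) a) F = integral UNIV F"
      by (rule sup[OF cF]) (use nx z in blast)
    moreover have "integral (cbox (- a) a) (\<lambda>x. F (x + ?s) - F x)
        = integral (cbox (- a) a) (\<lambda>x. F (x + ?s)) - integral (cbox (- a) a) F"
      using cs cF by (intro Henstock_Kurzweil_Integration.integral_diff integrable_continuous)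
        (auto intro: continuous_on_subset)
    ultimately show ?thesis unfolding g_def using sh by simp
  qed
  obtain M where M: "\<And>x. \<bar>pd i F x\<bar> \<le> M"
  proof -
    have "bounded (pd i F ` cball 0 R)"
      by (intro compact_imp_bounded compact_continuous_image continuous_on_subset[OF cont]) auto
    then obtain M where "\<forall>x\<in>cball 0 R. \<bar>pd i F x\<bar> \<le> M" unfolding bounded_iff by auto
    then have M: "\<And>x. norm x \<le> R \<Longrightarrow> \<bar>pd i F x\<bar> \<le> M" by simp
    have "\<bar>pd i F x\<bar> \<le> \<bar>M\<bar>" for x using M[of x] pz[of x] by (cases "norm x \<le> R") auto
    then show thesis by (rule that)
  qed
  have der: "((\<lambda>s. F (x + s *\<^sub>R e)) has_real_derivative pd i F (x + s *\<^sub>R e)) (at s)" for x s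
    unfolding e_def by (rule pd_line) (rule diff)
  have le: "norm (g k x) \<le> M" for k x
  proof -
    obtain \<xi> where "F (x + t k *\<^sub>R e) - F (x + 0 *\<^sub>R e) = (t k - 0) * pd i F (x + \<xi> *\<^sub>R e)"
      using MVT2[OF t(1)[of k], of "\<lambda>s. F (x + s *\<^sub>R e)" "\<lambda>s. pd i F (x + s *\<^sub>R e)"] der by blast
    then have "g k x = pd i F (x + \<xi> *\<^sub>R e)" using t(1)[of k] by (simp add: g_def)
    then show ?thesis using M by simp
  qed
  have lim: "(\<lambda>k. g k x) \<longlonglongrightarrow> pd i F x" for x
  proof -
    have "((\<lambda>h. (F (x + h *\<^sub>R e) - F x) / h) \<longlongrightarrow> pd i F x) (at 0)"
      using der[of x 0] by (simp add: DERIV_def)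
    moreover have "filterlim t (at 0) sequentially"
      using t0 t(1) by (auto simp: filterlim_at less_imp_neq[symmetric] intro!: always_eventually)
    ultimately show ?thesis unfolding g_def by (rule filterlim_compose)
  qed
  have "(\<lambda>k. integral (cbox (- a) a) (g k)) \<longlonglongrightarrow> integral (cbox (- a) a) (pd i F)"
    by (rule dominated_convergence(2)[where h = "\<lambda>x. M"])
      (use cg le lim in \<open>auto intro!: integrable_continuous intro: continuous_on_subset\<close>)
  then have "integral (cbox (- a) a) (pd i F) = 0"
    using ig LIMSEQ_unique[OF tendsto_const] by fastforce
  with sup[OF cont] nx pz show ?thesis by simp
qed

section \<open>The maximum principle for stable solutions\<close>

text \<open>\<open>cutoff d\<close> is a \<open>C\<^sup>1\<close> approximation of the positive part, and \<open>cutoff_dual d\<close> is the primitive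
  of the square of its derivative. Multiplying an equation for \<open>z\<close> by \<open>cutoff_dual d z\<close> therefore
  produces the Dirichlet energy of \<open>cutoff d z\<close>.\<close>
definition cutoff :: "real \<Rightarrow> real \<Rightarrow> real" where
  "cutoff d t = (if t \<le> d then 0 else (t - d)^2 / t)"

definition cutoff_dual :: "real \<Rightarrow> real \<Rightarrow> real" where
  "cutoff_dual d t = (if t \<le> d then 0 else (t - d)^3 * (3 * t + d) / (3 * t^3))"

text \<open>For d > 0, \<open>max d t\<close> yields the value 0 for t <= d, so one continuous
  formula covers both branches. The shape (t - d)^2 / t is chosen because the square of its
  derivative has the rational primitive t - 8d/3 + 2d^2/t - d^4/(3t^3), which is
  \<open>cutoff_dual\<close> for t > d.\<close>

definition cutoff' :: "real \<Rightarrow> real \<Rightarrow> real" where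
  "cutoff' d t = 1 - (d / max d t)^2"

text \<open>Both branches have value 0 and slope 0 at d, so both one-sided difference quotients tend
  to 0 there.\<close>

lemma DERIV_if_le:
  fixes h h' :: "real \<Rightarrow> real"
  assumes "\<And>t. t \<ge> d \<Longrightarrow> (h has_real_derivative h' t) (at t)" "h d = 0" "h' d = 0"
  shows "((\<lambda>t. if t \<le> d then 0 else h t) has_real_derivative (if t \<le> d then 0 else h' t)) (at t)"
    (is "(?f has_real_derivative _) _")
proof (cases t d rule: linorder_cases)
  case less
  have "(?f has_real_derivative 0) (at t)"
    by (rule has_field_derivative_transform_within_open[where S = "{..<d}" and f = "\<lambda>_. 0"]) (use less in auto)
  then show ?thesis using less by simp
next
  case greater
  have "(?f has_real_derivative h' t) (at t)"
    by (rule has_field_derivative_transform_within_open[where S = "{d<..}" and f = h])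
      (use greater assms(1) in auto)
  then show ?thesis using greater by simp
next
  case equal
  have h: "((\<lambda>y. (h y - h d) / (y - d)) \<longlongrightarrow> 0) (at d)"
    using assms(1)[of d] assms(3) by (simp add: has_field_derivative_iff)
  have "((\<lambda>y. (?f y - ?f d) / (y - d)) \<longlongrightarrow> 0) (at d)"
  proof (rule filterlim_split_at)
    have "\<forall>\<^sub>F y in at_left d. 0 = (?f y - ?f d) / (y - d)"
      by (auto simp: eventually_at_filter)
    then show "((\<lambda>y. (?f y - ?f d) / (y - d)) \<longlongrightarrow> 0) (at_left d)"
      by (rule Lim_transform_eventually[OF tendsto_const])
    have "\<forall>\<^sub>F y in at_right d. (h y - h d) / (y - d) = (?f y - ?f d) / (y - d)"
      using assms(2) by (auto simp: eventually_at_filter)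
    then show "((\<lambda>y. (?f y - ?f d) / (y - d)) \<longlongrightarrow> 0) (at_right d)"
      using h by (intro Lim_transform_eventually[OF filterlim_mono[OF h order_refl]]) (auto simp: at_le)
  qed
  then show ?thesis using equal by (simp add: has_field_derivative_iff)
qed

lemma cutoff'_continuous: "d > 0 \<Longrightarrow> continuous_on A (cutoff' d)"
  unfolding cutoff'_def by (intro continuous_intros) auto

lemma cutoff_deriv:
  assumes "d > 0"
  shows "(cutoff d has_real_derivative cutoff' d t) (at t)"
proof -
  have "((\<lambda>t. (t - d)^2 / t) has_real_derivative 1 - (d / t)^2) (at t)" if "t \<ge> d" for t
    using assms that by (auto intro!: derivative_eq_intros simp: field_simps power2_eq_square)
  from DERIV_if_le[where h = "\<lambda>t. (t - d)^2 / t" and h' = "\<lambda>t. 1 - (d / t)^2" and d = d, OF this]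
  have "(cutoff d has_real_derivative (if t \<le> d then 0 else 1 - (d / t)^2)) (at t)"
    using assms unfolding cutoff_def[abs_def] by simp
  moreover have "(if t \<le> d then 0 else 1 - (d / t)^2) = cutoff' d t"
    using assms by (auto simp: cutoff'_def max_def)
  ultimately show ?thesis by (simp only:)
qed

lemma cutoff_dual_deriv:
  assumes "d > 0"
  shows "(cutoff_dual d has_real_derivative (cutoff' d t)^2) (at t)"
proof -
  let ?h = "\<lambda>t. (t - d)^3 * (3 * t + d) / (3 * t^3)"
  have "(?h has_real_derivative (1 - (d / t)^2)^2) (at t)" if "t \<ge> d" for t
  proof -
    have "t > 0" using that assms by simp
    have "(?h has_real_derivative
      ((3 * (t - d)^2 * (3 * t + d) + 3 * (t - d)^3) * (3 * t^3) - (t - d)^3 * (3 * t + d) * (9 * t^2))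
         / ((3 * t^3) * (3 * t^3))) (at t)"
      using \<open>t > 0\<close> by (auto intro!: derivative_eq_intros simp: algebra_simps)
    moreover have "((3 * (t - d)^2 * (3 * t + d) + 3 * (t - d)^3) * (3 * t^3) - (t - d)^3 * (3 * t + d) * (9 * t^2))
         / ((3 * t^3) * (3 * t^3)) = (1 - (d / t)^2)^2"
    proof -
      have "(1 - (d / t)^2)^2 = ((t^2 - d^2)^2 * (9 * t^2)) / ((3 * t^3) * (3 * t^3))"
        using \<open>t > 0\<close> by (simp add: field_simps)
      also have "(t^2 - d^2)^2 * (9 * t^2) = (3 * (t - d)^2 * (3 * t + d) + 3 * (t - d)^3) * (3 * t^3) - (t - d)^3 * (3 * t + d) * (9 * t^2)"
        by (simp add: power2_eq_square power3_eq_cube algebra_simps)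
      finally show ?thesis by simp
    qed
    ultimately show ?thesis by simp
  qed
  from DERIV_if_le[where h = ?h and h' = "\<lambda>t. (1 - (d / t)^2)^2" and d = d, OF this]
  have "(cutoff_dual d has_real_derivative (if t \<le> d then 0 else (1 - (d / t)^2)^2)) (at t)"
    using assms unfolding cutoff_dual_def[abs_def] by simp
  moreover have "(if t \<le> d then 0 else (1 - (d / t)^2)^2) = (cutoff' d t)^2"
    using assms by (auto simp: cutoff'_def max_def)
  ultimately show ?thesis by (simp only:)
qed

lemma cutoff_dual_nonneg: "d > 0 \<Longrightarrow> cutoff_dual d t \<ge> 0"
  unfolding cutoff_dual_def by auto

text \<open>Testing the equation produces \<open>t * cutoff_dual d t\<close>, while stability
  involves \<open>(cutoff d t)^2\<close>. For t > d they differ by exactly 4d(t - d)^3/(3t^2), a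
  mismatch of first order in d.\<close>

lemma cutoff_defect:
  assumes "d > 0"
  shows "\<bar>t * cutoff_dual d t - (cutoff d t)^2\<bar> \<le> 2 * d * max 0 t"
proof (cases "t \<le> d")
  case True
  then show ?thesis using assms by (simp add: cutoff_def cutoff_dual_def)
next
  case False
  then have t: "t > d" "t > 0" using assms by auto
  have "t * cutoff_dual d t - (cutoff d t)^2 = 4 * d * (t - d)^3 / (3 * t^2)"
    using t unfolding cutoff_def cutoff_dual_def
    by (simp add: field_simps) (simp add: eval_nat_numeral algebra_simps)
  moreover have "4 * d * (t - d)^3 / (3 * t^2) \<le> 4 * d * t^3 / (3 * t^2)"
    using t assms by (intro divide_right_mono mult_left_mono power_mono) auto
  moreover have "4 * d * t^3 / (3 * t^2) = 4/3 * d * t"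
    using t by (simp add: power2_eq_square power3_eq_cube)
  moreover have "4/3 * d * t \<le> 2 * d * t" using t assms by simp
  moreover have "4 * d * (t - d)^3 / (3 * t^2) \<ge> 0" using t assms by simp
  moreover have "max 0 t = t" using t by simp
  ultimately show ?thesis by linarith
qed

lemma cutoff_ge:
  assumes "d > 0" shows "cutoff d t \<ge> t - 2 * d"
  using assms by (simp add: cutoff_def field_simps power2_eq_square)

text \<open>The field \<open>cutoff_dual d z\<close> times grad z has divergence
  \<open>cutoff_dual d z\<close> times the Laplacian of z plus the squared gradient of
  \<open>cutoff d z\<close>, and this divergence integrates to 0. With the inequality for z, the
  stability functional at \<open>cutoff d z\<close> is therefore at most the integrated defect,
  which bounds the L^2 norm.\<close>

lemma energy_estimate:
  fixes \<Omega> D :: "(real^'n::finite) set" and V z :: "real^'n \<Rightarrow> real"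
  assumes \<Omega>: "open \<Omega>" "bounded \<Omega>"
    and V: "continuous_on \<Omega> V" "\<And>x. x \<in> \<Omega> \<Longrightarrow> \<bar>V x\<bar> \<le> K"
    and stab: "\<And>\<phi>. test_fun \<Omega> \<phi> \<Longrightarrow>
       integral \<Omega> (\<lambda>x. \<Sum>i\<in>UNIV. (pd i \<phi> x)^2) - integral \<Omega> (\<lambda>x. V x * (\<phi> x)^2)
         \<ge> c * integral \<Omega> (\<lambda>x. (\<phi> x)^2)"
    and D: "open D" "D \<subseteq> \<Omega>" and z: "C2_on D z" "\<And>x. x \<in> D \<Longrightarrow> z x \<le> M" "M \<ge> 0"
    and sub: "\<And>x. x \<in> D \<Longrightarrow> z x > 0 \<Longrightarrow> 0 \<le> laplacian z x + V x * z x"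
    and S: "compact {x \<in> D. z x \<ge> d}" and d: "d > 0"
  shows "c * integral \<Omega> (\<lambda>x. (zero_ext D (\<lambda>x. cutoff d (z x)) x)^2) \<le> d * (2 * K * M * measure lebesgue \<Omega>)"
    and "(\<lambda>x. (zero_ext D (\<lambda>x. cutoff d (z x)) x)^2) integrable_on \<Omega>"
proof -
  note Z = C2_onD[OF z(1) D(1)]
  \<comment> \<open>Both truncations vanish off \<open>S\<close>. As \<open>S\<close> is compact
    inside \<open>D\<close>, their extensions by zero are C^1 with compact support, whatever z does
    near the boundary of \<open>D\<close>.\<close>
  define S where "S = {x \<in> D. z x \<ge> d}"
  have cS: "compact S" using S unfolding S_def .
  have "S \<subseteq> D" unfolding S_def by blast
  then have S: "closed S" "bounded S" "S \<subseteq> D" "S \<subseteq> \<Omega>"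
    using D(2) compact_imp_closed[OF cS] compact_imp_bounded[OF cS] by auto
  have zd: "z x < d" if "x \<in> D" "x \<notin> S" for x using that by (auto simp: S_def)
  have z0: "cutoff d (z x) = 0" "cutoff_dual d (z x) = 0" "cutoff' d (z x) = 0" if "x \<in> D" "x \<notin> S" for x
    using zd[OF that] d by (auto simp: cutoff_def cutoff_dual_def cutoff'_def max_def)
  define \<phi> where "\<phi> = zero_ext D (\<lambda>x. cutoff d (z x))"
  define F where "F i = zero_ext D (\<lambda>x. cutoff_dual d (z x) * pd i z x)" for i
  note ch = pd_chain[OF cutoff_deriv[OF d] Z(1)] pd_chain[OF cutoff_dual_deriv[OF d] Z(1)]
  have ccut: "continuous_on A (cutoff d)" "continuous_on A (cutoff_dual d)" for A
    by (intro continuous_at_imp_continuous_on ballI DERIV_isCont[OF cutoff_deriv[OF d]]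
        DERIV_isCont[OF cutoff_dual_deriv[OF d]])+
  have cz: "continuous_on D (\<lambda>x. cutoff d (z x))" "continuous_on D (\<lambda>x. cutoff_dual d (z x))"
    "continuous_on D (\<lambda>x. cutoff' d (z x))"
    by (rule continuous_on_compose2[OF ccut(1)[of UNIV] Z(3)]
        continuous_on_compose2[OF ccut(2)[of UNIV] Z(3)]
        continuous_on_compose2[OF cutoff'_continuous[OF d, of UNIV] Z(3)], simp)+
  have zero_ext_cong: "zero_ext D h = zero_ext D h'" if "\<And>x. x \<in> D \<Longrightarrow> h x = h' x" for h h'
    using that by (auto simp: zero_ext_def)
  have \<phi>: "\<phi> differentiable (at x)" for x
    unfolding \<phi>_def by (rule zero_ext_pd(1)[OF D(1) S(1,3)]) (use z0 ch in auto)
  have pd\<phi>: "pd i \<phi> = zero_ext D (\<lambda>x. cutoff' d (z x) * pd i z x)" for i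
  proof -
    have "pd i \<phi> = zero_ext D (pd i (\<lambda>x. cutoff d (z x)))"
      unfolding \<phi>_def by (rule zero_ext_pd(2)[OF D(1) S(1,3)]) (use z0 ch in auto)
    also have "\<dots> = zero_ext D (\<lambda>x. cutoff' d (z x) * pd i z x)"
      by (rule zero_ext_cong) (rule ch(1))
    finally show ?thesis .
  qed
  have cpd\<phi>: "continuous_on UNIV (pd i \<phi>)" for i
    unfolding pd\<phi> by (rule zero_ext_continuous[OF D(1) S(1,3)])
      (use z0 in \<open>auto intro!: continuous_intros cz Z\<close>)
  have c\<phi>: "continuous_on UNIV \<phi>"
    unfolding \<phi>_def by (rule zero_ext_continuous[OF D(1) S(1,3)]) (use z0 cz in auto)
  have dF: "(\<lambda>x. cutoff_dual d (z x) * pd i z x) differentiable (at x)" if "x \<in> D" for i x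
    by (intro differentiable_mult ch Z that)
  have F: "F i differentiable (at x)" for i x
    unfolding F_def by (rule zero_ext_pd(1)[OF D(1) S(1,3)]) (use z0 dF in auto)
  have pdF: "pd i (F i) = zero_ext D (\<lambda>x. cutoff_dual d (z x) * pd i (pd i z) x
      + (cutoff' d (z x))^2 * pd i z x * pd i z x)" for i
  proof -
    have "pd i (F i) = zero_ext D (pd i (\<lambda>x. cutoff_dual d (z x) * pd i z x))"
      unfolding F_def by (rule zero_ext_pd(2)[OF D(1) S(1,3)]) (use z0 dF in auto)
    also have "\<dots> = zero_ext D (\<lambda>x. cutoff_dual d (z x) * pd i (pd i z) x
      + (cutoff' d (z x))^2 * pd i z x * pd i z x)"
      by (rule zero_ext_cong) (simp add: pd_mult ch Z)
    finally show ?thesis .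
  qed
  have cpdF: "continuous_on UNIV (pd i (F i))" for i
    unfolding pdF by (rule zero_ext_continuous[OF D(1) S(1,3)])
      (use z0 in \<open>auto intro!: continuous_intros cz Z\<close>)
  have sup: "\<phi> x = 0" "pd i \<phi> x = 0" "F i x = 0" "pd i (F i) x = 0" if "x \<notin> S" for x i
    using that z0[of x] unfolding pd\<phi> pdF unfolding \<phi>_def F_def zero_ext_def by auto
  have iF0: "integral \<Omega> (pd i (F i)) = 0" and iF: "pd i (F i) integrable_on \<Omega>" for i
    using integral_continuous_compact_support[OF cpdF[of i] S(2) sup(4) S(4)]
      integral_pd_eq_0[OF F cpdF S(2) sup(3)] by auto
  have tf: "test_fun \<Omega> \<phi>"
  proof -
    have "{x. \<phi> x \<noteq> 0} \<subseteq> S" using sup(1) by blast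
    then have "closure {x. \<phi> x \<noteq> 0} \<subseteq> S" using S(1) by (rule closure_minimal)
    moreover from this have "compact (closure {x. \<phi> x \<noteq> 0})"
      using S(2) by (auto simp: compact_eq_bounded_closed intro: bounded_subset)
    ultimately show ?thesis using \<phi> cpd\<phi> S(4)
      unfolding test_fun_def differentiable_on_def by blast
  qed
  have i1: "(\<lambda>x. \<Sum>i\<in>UNIV. (pd i \<phi> x)^2) integrable_on \<Omega>"
    by (rule integral_continuous_compact_support(1)[OF _ S(2) _ S(4)])
      (use sup in \<open>auto intro!: continuous_intros cpd\<phi>\<close>)
  show i2: "(\<lambda>x. (zero_ext D (\<lambda>x. cutoff d (z x)) x)^2) integrable_on \<Omega>"
    unfolding \<phi>_def[symmetric]
    by (rule integral_continuous_compact_support(1)[OF _ S(2) _ S(4)])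
      (use sup in \<open>auto intro!: continuous_intros c\<phi>\<close>)
  have i3: "(\<lambda>x. V x * (\<phi> x)^2) integrable_on \<Omega>"
  proof -
    have "zero_ext \<Omega> (\<lambda>x. V x * (\<phi> x)^2) integrable_on \<Omega>"
    proof (rule integral_continuous_compact_support(1)[OF _ S(2) _ S(4)])
      show "continuous_on UNIV (zero_ext \<Omega> (\<lambda>x. V x * (\<phi> x)^2))"
        by (rule zero_ext_continuous[OF \<Omega>(1) S(1,4)])
          (use sup in \<open>auto intro!: continuous_intros V continuous_on_subset[OF c\<phi>]\<close>)
    qed (use sup in \<open>auto simp: zero_ext_def\<close>)
    then show ?thesis by (rule integrable_eq) (simp add: zero_ext_def)
  qed
  have K: "K \<ge> 0" if "x \<in> \<Omega>" for x using V(2)[OF that] by linarith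
  have ptw: "(\<Sum>i\<in>UNIV. (pd i \<phi> x)^2) - V x * (\<phi> x)^2 \<le> (\<Sum>i\<in>UNIV. pd i (F i) x) + 2 * K * M * d"
    if "x \<in> \<Omega>" for x
  proof (cases "x \<in> D")
    case False
    then show ?thesis using K[OF that] z(3) d by (simp add: pd\<phi> pdF) (simp add: \<phi>_def zero_ext_def)
  next
    case True
    let ?t = "z x"
    have 1: "(\<Sum>i\<in>UNIV. pd i (F i) x) = cutoff_dual d ?t * laplacian z x + (\<Sum>i\<in>UNIV. (pd i \<phi> x)^2)"
      using True by (simp add: pd\<phi> pdF zero_ext_def sum.distrib laplacian_def sum_distrib_left
          power2_eq_square algebra_simps)
    \<comment> \<open>Where z <= 0 the hypothesis \<open>sub\<close> says nothing, but there
      \<open>cutoff_dual d\<close> vanishes.\<close>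
    have 2: "0 \<le> cutoff_dual d ?t * (laplacian z x + V x * ?t)"
    proof (cases "?t > 0")
      case True then show ?thesis using sub[OF \<open>x \<in> D\<close>] cutoff_dual_nonneg[OF d] by simp
    qed (use d in \<open>simp add: cutoff_dual_def\<close>)
    have "\<bar>V x * (?t * cutoff_dual d ?t - (cutoff d ?t)^2)\<bar> \<le> K * (2 * d * max 0 ?t)"
      unfolding abs_mult by (intro mult_mono V(2) that cutoff_defect d abs_ge_zero K[OF that])
    also have "\<dots> \<le> K * (2 * d * M)"
      using K[OF that] d z(2)[OF True] z(3) by (intro mult_left_mono) auto
    finally have "V x * (?t * cutoff_dual d ?t - (cutoff d ?t)^2) \<le> 2 * K * M * d"
      by (simp add: algebra_simps)
    moreover have "\<phi> x = cutoff d ?t" using True by (simp add: \<phi>_def zero_ext_def)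
    ultimately show ?thesis using 1 2 by (simp add: algebra_simps)
  qed
  have lm: "\<Omega> \<in> lmeasurable" using \<Omega> by (rule lmeasurable_open[rotated])
  have ic: "(\<lambda>x. C :: real) integrable_on \<Omega>" for C using lm by (rule integrable_on_const)
  have "c * integral \<Omega> (\<lambda>x. (\<phi> x)^2)
      \<le> integral \<Omega> (\<lambda>x. (\<Sum>i\<in>UNIV. (pd i \<phi> x)^2) - V x * (\<phi> x)^2)"
    using stab[OF tf] Henstock_Kurzweil_Integration.integral_diff[OF i1 i3] by simp
  also have "\<dots> \<le> integral \<Omega> (\<lambda>x. (\<Sum>i\<in>UNIV. pd i (F i) x) + 2 * K * M * d)"
    by (intro integral_le integrable_diff i1 i3 integrable_add ic integrable_sum iF ptw) auto
  also have "\<dots> = integral \<Omega> (\<lambda>x. \<Sum>i\<in>UNIV. pd i (F i) x) + integral \<Omega> (\<lambda>x. 2 * K * M * d)"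
    by (intro Henstock_Kurzweil_Integration.integral_add ic integrable_sum iF) auto
  also have "integral \<Omega> (\<lambda>x. \<Sum>i\<in>UNIV. pd i (F i) x) = 0"
    by (subst Henstock_Kurzweil_Integration.integral_sum) (auto simp: iF0 iF)
  also have "integral \<Omega> (\<lambda>x. 2 * K * M * d) = d * (2 * K * M * measure lebesgue \<Omega>)"
    using lmeasure_integral[OF lm] Henstock_Kurzweil_Integration.integral_mult_right[of \<Omega> "2 * K * M * d" "\<lambda>x. 1"]
    by simp
  finally show "c * integral \<Omega> (\<lambda>x. (zero_ext D (\<lambda>x. cutoff d (z x)) x)^2) \<le> d * (2 * K * M * measure lebesgue \<Omega>)"
    unfolding \<phi>_def by simp
qed

text \<open>If z were positive at a point, its truncations would keep a fixed amount of L^2 mass on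
  a small box as d tends to 0, against the bound of order d in
  \<open>energy_estimate\<close>.\<close>

lemma stable_max_principle:
  fixes \<Omega> D :: "(real^'n::finite) set" and z u :: "real^'n \<Rightarrow> real"
  assumes \<Omega>: "open \<Omega>" "bounded \<Omega>" and stab: "stable \<Omega> f' u"
    and V: "continuous_on \<Omega> (\<lambda>x. f' (u x))" "\<And>x. x \<in> \<Omega> \<Longrightarrow> \<bar>f' (u x)\<bar> \<le> K"
    and D: "open D" "D \<subseteq> \<Omega>" and z: "C2_on D z"
    and sub: "\<And>x. x \<in> D \<Longrightarrow> z x > 0 \<Longrightarrow> 0 \<le> laplacian z x + f' (u x) * z x"
    and S: "\<And>d. d > 0 \<Longrightarrow> compact {x \<in> D. z x \<ge> d}" and x: "x \<in> D"
  shows "z x \<le> 0"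
proof (rule ccontr)
  assume "\<not> z x \<le> 0"
  define \<eta> where "\<eta> = z x / 2"
  have \<eta>: "\<eta> > 0" "\<eta> < z x" using \<open>\<not> z x \<le> 0\<close> by (auto simp: \<eta>_def)
  note cz = C2_onD(3)[OF z D(1)]
  obtain c where c: "c > 0" "\<And>\<phi>. test_fun \<Omega> \<phi> \<Longrightarrow>
       integral \<Omega> (\<lambda>x. \<Sum>i\<in>UNIV. (pd i \<phi> x)^2) - integral \<Omega> (\<lambda>x. f' (u x) * (\<phi> x)^2)
         \<ge> c * integral \<Omega> (\<lambda>x. (\<phi> x)^2)"
    using stab unfolding stable_def by blast
  have "open {y \<in> D. \<eta> < z y}"
  proof -
    have "{y \<in> D. \<eta> < z y} = D \<inter> z -` {\<eta><..}" by auto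
    then show ?thesis using continuous_open_preimage[OF cz D(1) open_greaterThan[of \<eta>]] by simp
  qed
  moreover have "x \<in> {y \<in> D. \<eta> < z y}" using x \<eta>(2) by simp
  ultimately obtain a b where ab: "cbox a b \<subseteq> {y \<in> D. \<eta> < z y}"
      "\<forall>i\<in>Basis. a \<bullet> i < b \<bullet> i"
    by (rule open_contains_cbox)
  define m where "m = measure lborel (cbox a b)"
  have m: "m > 0" unfolding m_def using ab(2) by (rule content_pos_lt)
  \<comment> \<open>Compactness bounds z where it is at least \<eta>; elsewhere \<eta> itself is a
    bound.\<close>
  obtain M where M: "\<And>y. y \<in> D \<Longrightarrow> z y \<le> M" "M \<ge> 0"
  proof -
    have "compact (z ` {y \<in> D. \<eta> \<le> z y})"
      using cz S[OF \<eta>(1)] by (intro compact_continuous_image) (auto intro: continuous_on_subset)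
    then obtain M where "\<forall>y. y \<in> D \<and> \<eta> \<le> z y \<longrightarrow> \<bar>z y\<bar> \<le> M"
      by (auto dest!: compact_imp_bounded simp: bounded_iff)
    then have "z y \<le> max M \<eta>" if "y \<in> D" for y using that by (cases "\<eta> \<le> z y") force+
    then show thesis using that[of "max M \<eta>"] \<eta> by auto
  qed
  define B where "B = 2 * K * M * measure lebesgue \<Omega>"
  have "K \<ge> 0" using V(2)[of x] x D(2) by force
  then have B: "B \<ge> 0" using M(2) by (simp add: B_def)
  define A where "A = c * ((\<eta> / 2)^2 * m)"
  have A: "A > 0" using c(1) m \<eta>(1) by (simp add: A_def)
  have key: "A \<le> d * B" if d: "d > 0" "d \<le> \<eta> / 4" for d
  proof -
    let ?\<phi> = "zero_ext D (\<lambda>x. cutoff d (z x))"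
    note E = energy_estimate[OF \<Omega> V c(2) D z M sub S[OF d(1)] d(1)]
    have int: "(\<lambda>x. (?\<phi> x)^2) integrable_on cbox a b"
      by (rule integrable_on_subcbox[OF E(2)]) (use ab D in auto)
    have "(\<eta> / 2)^2 * m = integral (cbox a b) (\<lambda>x. (\<eta> / 2)^2)" by (simp add: m_def)
    also have "\<dots> \<le> integral (cbox a b) (\<lambda>x. (?\<phi> x)^2)"
    proof (intro integral_le int power_mono)
      fix y assume "y \<in> cbox a b"
      then have y: "y \<in> D" "\<eta> < z y" using ab by auto
      show "\<eta> / 2 \<le> ?\<phi> y" using y cutoff_ge[OF d(1), of "z y"] d(2) by (simp add: zero_ext_def)
    qed (use \<eta> in auto)
    also have "\<dots> \<le> integral \<Omega> (\<lambda>x. (?\<phi> x)^2)"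
      by (rule integral_subset_le) (use ab D int E(2) in auto)
    finally have "A \<le> c * integral \<Omega> (\<lambda>x. (?\<phi> x)^2)" using c(1) by (simp add: A_def)
    also have "\<dots> \<le> d * B" unfolding B_def using E(1) by simp
    finally show ?thesis .
  qed
  \<comment> \<open>The bound \<eta>/4 makes \<open>cutoff_ge\<close> leave at least \<eta>/2 on the
    box. The other bound gives d B <= A/2, with B + 1 in place of B because B may be 0.\<close>
  define d where "d = min (\<eta> / 4) (A / (2 * (B + 1)))"
  have "d > 0" using A B \<eta> by (simp add: d_def)
  moreover have "d \<le> \<eta> / 4" unfolding d_def by (rule min.cobounded1)
  ultimately have "A \<le> d * B" by (rule key)
  also have "\<dots> \<le> A / (2 * (B + 1)) * B" unfolding d_def using B by (intro mult_right_mono min.cobounded2)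
  also have "\<dots> < A" using A B by (simp add: field_simps add_nonneg_pos)
  finally show False by simp
qed

section \<open>Reflection in coordinate hyperplanes\<close>

lemma coord_convexD:
  assumes "coord_convex i \<Omega>" "P \<in> \<Omega>" "Q \<in> \<Omega>" "\<And>j. j \<noteq> i \<Longrightarrow> R$j = P$j" "\<And>j. j \<noteq> i \<Longrightarrow> R$j = Q$j"
    "P$i \<le> R$i" "R$i \<le> Q$i"
  shows "R \<in> \<Omega>"
proof (cases "P$i = Q$i")
  case True
  then have "R = P" using assms by (auto simp: vec_eq_iff) (metis order_antisym)
  then show ?thesis using assms by simp
next
  case False
  define t where "t = (R$i - P$i) / (Q$i - P$i)"
  have t: "0 \<le> t" "t \<le> 1" using assms(6,7) False by (auto simp: t_def divide_simps)
  have "R = (1 - t) *\<^sub>R P + t *\<^sub>R Q"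
  proof (rule vec_eq_iff[THEN iffD2], rule allI)
    fix j
    show "R$j = ((1 - t) *\<^sub>R P + t *\<^sub>R Q)$j"
    proof (cases "j = i")
      case True
      have "t * (Q$i - P$i) = R$i - P$i" using False by (simp add: t_def)
      then show ?thesis using True by (simp add: algebra_simps)
    next
      case False
      then have "P$j = R$j" "Q$j = R$j" using assms(4,5) by metis+
      then show ?thesis by (simp add: algebra_simps)
    qed
  qed
  then have "R \<in> closed_segment P Q" using t by (auto simp: in_segment)
  moreover have "closed_segment P Q \<subseteq> \<Omega>"
    using assms(1,2,3) assms(4,5) unfolding coord_convex_def by metis
  ultimately show ?thesis by blast
qed

text \<open>The geometry is recorded as reflection symmetry and convexity in every coordinate, so
  that the axis of rotation and the other directions are treated alike.\<close>

locale stable_solution =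
  fixes \<Omega> :: "(real^'n::finite) set" and u :: "real^'n \<Rightarrow> real" and f f' :: "real \<Rightarrow> real"
  assumes open_dom: "open \<Omega>" and bounded_dom: "bounded \<Omega>"
    and refl_dom: "x \<in> \<Omega> \<Longrightarrow> refl_at i 0 x \<in> \<Omega>"
    and convex_dom: "coord_convex i \<Omega>"
    and f_deriv: "(f has_real_derivative f' t) (at t)" and f'_cont: "continuous_on UNIV f'"
    and f_convex: "convex_on UNIV f"
    and u_C2: "C2_on \<Omega> u" and u_cont: "continuous_on (closure \<Omega>) u"
    and pde: "x \<in> \<Omega> \<Longrightarrow> - laplacian u x = f (u x)"
    and u_frontier: "x \<in> frontier \<Omega> \<Longrightarrow> u x = 0"
    and u_pos: "x \<in> \<Omega> \<Longrightarrow> u x > 0"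
    and u_stable: "stable \<Omega> f' u"
begin

text \<open>The boundary condition makes this extension continuous on the whole space. It serves
  where closed superlevel sets are needed and where a ray leaves \<Omega>.\<close>

definition U :: "real^'n \<Rightarrow> real" where "U = zero_ext \<Omega> u"

lemma U_in: "x \<in> \<Omega> \<Longrightarrow> U x = u x" and U_out: "x \<notin> \<Omega> \<Longrightarrow> U x = 0" and U_nonneg: "U x \<ge> 0"
  using u_pos[of x] by (auto simp: U_def zero_ext_def)

lemma U_continuous: "continuous_on UNIV U"
proof -
  have "continuous_on (closure \<Omega> \<union> - \<Omega>) U"
  proof (rule continuous_on_closed_Un)
    have "U x = u x" if "x \<in> closure \<Omega>" for x
      using that U_in[of x] U_out[of x] u_frontier[of x] interior_open[OF open_dom]
      by (cases "x \<in> \<Omega>") (auto simp: frontier_def)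
    then show "continuous_on (closure \<Omega>) U"
      using u_cont by (simp cong: continuous_on_cong)
    show "continuous_on (- \<Omega>) U"
      by (subst continuous_on_cong[of _ "- \<Omega>" _ "\<lambda>x. 0"]) (auto simp: U_out)
  qed (use open_dom in auto)
  moreover have "closure \<Omega> \<union> - \<Omega> = UNIV" using closure_subset by auto
  ultimately show ?thesis by simp
qed

lemma f'_u_continuous: "continuous_on \<Omega> (\<lambda>x. f' (u x))"
  by (rule continuous_on_compose2[OF f'_cont C2_onD(3)[OF u_C2 open_dom]]) simp

text \<open>Fixed once for all reflecting planes; the uniform Hopf constant near the origin rests on
  this.\<close>

definition K :: real where "K = (SOME K. \<forall>x\<in>\<Omega>. \<bar>f' (u x)\<bar> \<le> K)"

lemma f'_u_bound: "x \<in> \<Omega> \<Longrightarrow> \<bar>f' (u x)\<bar> \<le> K"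
proof -
  have "compact ((\<lambda>x. f' (u x)) ` closure \<Omega>)"
    by (rule compact_continuous_image[OF continuous_on_compose2[OF f'_cont u_cont]])
      (use bounded_dom in auto)
  then obtain B where "\<forall>y\<in>(\<lambda>x. f' (u x)) ` closure \<Omega>. norm y \<le> B"
    using compact_imp_bounded bounded_iff by metis
  then have "\<forall>x\<in>\<Omega>. \<bar>f' (u x)\<bar> \<le> B" using closure_subset[of \<Omega>] by auto
  then have "\<forall>x\<in>\<Omega>. \<bar>f' (u x)\<bar> \<le> K" unfolding K_def by (rule someI)
  then show "x \<in> \<Omega> \<Longrightarrow> \<bar>f' (u x)\<bar> \<le> K" by blast
qed

text \<open>For s = 1 the reflected coordinate 2c - x_i lies between -x_i and x_i, the coordinates
  of \<open>refl_at i 0 x\<close> and \<open>x\<close>, and convexity along the axis applies. The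
  sign s = -1 is the mirrored situation.\<close>

lemma refl_at_dom:
  assumes "s = 1 \<or> s = -1" "s * c \<ge> 0" "x \<in> \<Omega>" "s * x$i \<ge> s * c"
  shows "refl_at i c x \<in> \<Omega>"
  using assms(1)
proof
  assume "s = 1"
  then show ?thesis
    using assms by - (rule coord_convexD[OF convex_dom, of "refl_at i 0 x" x i], auto simp: refl_dom)
next
  assume "s = -1"
  then show ?thesis
    using assms by - (rule coord_convexD[OF convex_dom, of x "refl_at i 0 x" i], auto simp: refl_dom)
qed

text \<open>Convexity of \<open>f\<close> enters through the tangent at \<open>u x\<close>, not at
  the reflected value, so that the coefficient is exactly the potential in the stability
  condition.\<close>

lemma laplacian_refl_diff:
  assumes "x \<in> \<Omega>" "refl_at i c x \<in> \<Omega>"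
  shows "laplacian (\<lambda>x. u (refl_at i c x) - u x) x = f (u x) - f (u (refl_at i c x))"
    and "C2_on (\<Omega> \<inter> refl_at i c -` \<Omega>) (\<lambda>x. u (refl_at i c x) - u x)"
    and "f' (u x) * (u (refl_at i c x) - u x) \<le> f (u (refl_at i c x)) - f (u x)"
proof -
  let ?D = "\<Omega> \<inter> refl_at i c -` \<Omega>"
  have o: "open ?D" using open_dom open_refl_at_vimage by blast
  note R = C2_on_refl_at[OF open_dom u_C2, of i c]
  note d = C2_on_diff[OF o C2_on_subset[OF R(1)] C2_on_subset[OF u_C2], OF Int_lower2 Int_lower1]
  show "C2_on ?D (\<lambda>x. u (refl_at i c x) - u x)" by (rule d(1))
  show "laplacian (\<lambda>x. u (refl_at i c x) - u x) x = f (u x) - f (u (refl_at i c x))"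
    using d(2)[of x] assms R(2)[of x] pde[of x] pde[of "refl_at i c x"] by simp
  show "f' (u x) * (u (refl_at i c x) - u x) \<le> f (u (refl_at i c x)) - f (u x)"
    using convex_on_imp_above_tangent[OF f_convex _ _ _ f_deriv, of "u x" "u (refl_at i c x)"] by simp
qed

text \<open>By convexity of \<open>f\<close> the difference \<open>u - u \<circ> refl\<close> is a subsolution of the linearised equation on
  the cap; stability replaces the usual moving of the plane by a single comparison.\<close>
lemma cap_comparison:
  assumes s: "s = 1 \<or> s = -1" "s * c \<ge> 0" and x: "x \<in> \<Omega>" "s * x$i > s * c"
  shows "u x \<le> u (refl_at i c x)"
proof -
  define D where "D = {x \<in> \<Omega>. s * x$i > s * c}"
  define z where "z x = u x - u (refl_at i c x)" for x
  have "D = \<Omega> \<inter> {x. s * c < s * x$i}" by (auto simp: D_def)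
  then have D: "open D" "D \<subseteq> \<Omega>"
    using open_dom by (auto intro!: open_Int open_Collect_less continuous_intros)
  have xD: "x \<in> D" using x unfolding D_def by blast
  have R: "refl_at i c x \<in> \<Omega>" if "x \<in> D" for x
    using that refl_at_dom[OF s] by (auto simp: D_def)
  have C: "C2_on D (\<lambda>x. u (refl_at i c x))"
    by (rule C2_on_subset[OF C2_on_refl_at(1)[OF open_dom u_C2]]) (use R in auto)
  note d = C2_on_diff[OF D(1) C2_on_subset[OF u_C2 D(2)] C]
  have "z x \<le> 0"
  proof (rule stable_max_principle[OF open_dom bounded_dom u_stable f'_u_continuous f'_u_bound D, of z])
    show "C2_on D z" unfolding z_def using d(1) .
    show "0 \<le> laplacian z x + f' (u x) * z x" if "x \<in> D" for x
    proof -
      have "laplacian z x = f (u (refl_at i c x)) - f (u x)"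
        unfolding z_def using d(2)[OF that] C2_on_refl_at(2)[OF open_dom u_C2 R[OF that]]
          pde[of x] pde[OF R[OF that]] that D by force
      then show ?thesis using laplacian_refl_diff(3)[OF _ R[OF that]] that D
        by (auto simp: z_def algebra_simps)
    qed
    show "compact {x \<in> D. d \<le> z x}" if "d > 0" for d
    proof -
      \<comment> \<open>The right side is closed because \<open>U\<close> is continuous. It adds no
        points: a difference of at least d > 0 forces \<open>U x > 0\<close>, hence x in \<Omega>,
        and excludes the plane, where the difference is 0.\<close>
      have "{x \<in> D. d \<le> z x} = {x. s * c \<le> s * x$i} \<inter> {x. d \<le> U x - U (refl_at i c x)}" (is "?A = ?B")
      proof
        show "?A \<subseteq> ?B" using R D by (auto simp: U_in z_def) (auto simp: D_def)
        show "?B \<subseteq> ?A"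
        proof
          fix x assume x: "x \<in> ?B"
          then have "U x > 0" using \<open>d > 0\<close> U_nonneg[of "refl_at i c x"] by auto
          then have x1: "x \<in> \<Omega>" using U_out by force
          have "x$i \<noteq> c"
          proof
            assume "x$i = c"
            then have "refl_at i c x = x" by (simp add: vec_eq_iff)
            then show False using x \<open>d > 0\<close> by simp
          qed
          then have "x \<in> D" using x1 x s by (auto simp: D_def)
          then show "x \<in> ?A" using x R x1 by (auto simp: z_def U_in)
        qed
      qed
      moreover have "closed ?B"
        by (intro closed_Int closed_Collect_le continuous_intros U_continuous
            continuous_on_compose2[OF U_continuous]) auto
      moreover have "bounded ?A" using bounded_dom D by (auto intro: bounded_subset)
      ultimately show ?thesis by (simp add: compact_eq_bounded_closed)
    qed
  qed (simp_all add: xD)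
  then show ?thesis by (simp add: z_def)
qed

text \<open>For c = 0 both sides of the plane are admissible: comparison at x with s = 1 and at its
  mirror image with s = -1 gives opposite inequalities.\<close>

lemma u_symmetric: "x \<in> \<Omega> \<Longrightarrow> u (refl_at i 0 x) = u x"
proof -
  have "u x = u (refl_at i 0 x)" if x: "x \<in> \<Omega>" "x$i > 0" for x
    using cap_comparison[of 1 0 x i] cap_comparison[of "-1" 0 "refl_at i 0 x" i] x
      refl_dom[of x i] by simp
  moreover have "refl_at i 0 x = x" if "x$i = 0" for x :: "real^'n"
    using that by (simp add: vec_eq_iff)
  moreover assume "x \<in> \<Omega>"
  moreover have "x$i > 0 \<or> (refl_at i 0 x)$i > 0 \<or> x$i = 0" by auto
  ultimately show ?thesis using refl_dom refl_at_idem by metis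
qed

end

section \<open>Barriers, the strong maximum principle and Hopf's lemma\<close>

text \<open>On each coordinate line through x the first derivative vanishes. A negative second
  derivative would make it negative just after x, and the mean value theorem would give a smaller
  value.\<close>

lemma laplacian_nonneg_at_min:
  fixes z :: "real^'n::finite \<Rightarrow> real"
  assumes "open D" "C2_on D z" "x \<in> D" "r > 0" "\<And>y. dist x y < r \<Longrightarrow> z x \<le> z y"
  shows "laplacian z x \<ge> 0"
  unfolding laplacian_def
proof (rule sum_nonneg)
  fix i :: 'n
  note Z = C2_onD[OF assms(2,1)]
  let ?p = "\<lambda>t. x + t *\<^sub>R axis i (1::real)"
  obtain r' where r': "r' > 0" "ball x r' \<subseteq> D" using assms(1,3) open_contains_ball by blast
  define s where "s = min r r'"
  have s: "s > 0" using r' assms(4) by (simp add: s_def)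
  have p: "dist x (?p t) = \<bar>t\<bar>" for t by (simp add: dist_norm)
  have pD: "?p t \<in> D" if "\<bar>t\<bar> < s" for t
    using that p[of t] r'(2) by (auto simp: s_def)
  have g: "((\<lambda>t. z (?p t)) has_real_derivative pd i z (?p t)) (at t)" if "\<bar>t\<bar> < s" for t
    by (rule pd_line) (rule Z(1)[OF pD[OF that]])
  have g': "((\<lambda>t. pd i z (?p t)) has_real_derivative pd i (pd i z) x) (at 0)"
    using pd_line[where t = 0 and g = "pd i z" and x = x and i = i] Z(2)[OF assms(3)] by simp
  have min: "z x \<le> z (?p t)" if "\<bar>t\<bar> < s" for t
    using assms(5)[of "?p t"] that p[of t] by (simp add: s_def)
  have 0: "pd i z x = 0"
    using DERIV_local_min[OF g[of 0] s] s min by simp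
  show "pd i (pd i z) x \<ge> 0"
  proof (rule ccontr)
    assume "\<not> pd i (pd i z) x \<ge> 0"
    then obtain e where e: "e > 0" "\<And>h. 0 < h \<Longrightarrow> h < e \<Longrightarrow> pd i z (?p h) < 0"
      using DERIV_neg_dec_right[OF g'] 0 by auto
    define h where "h = min e s / 2"
    have h: "0 < h" "h < e" "h < s" using e(1) s by (auto simp: h_def)
    obtain \<xi> where \<xi>: "0 < \<xi>" "\<xi> < h" "z (?p h) - z (?p 0) = (h - 0) * pd i z (?p \<xi>)"
      using MVT2[OF h(1), of "\<lambda>t. z (?p t)" "\<lambda>t. pd i z (?p t)"] g h by force
    have "pd i z (?p \<xi>) < 0" using e(2) \<xi> h by simp
    then have "z (?p h) < z x" using \<xi>(3) h(1) mult_pos_neg[of h "pd i z (?p \<xi>)"] by simp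
    then show False using min[of h] h by simp
  qed
qed

text \<open>Hopf's comparison function. For positive m, \<alpha> and \<rho> it vanishes on the
  sphere of radius \<rho> about y, is positive inside and stays below m.\<close>

definition barrier :: "real \<Rightarrow> real \<Rightarrow> real \<Rightarrow> real^'n::finite \<Rightarrow> real^'n \<Rightarrow> real" where
  "barrier m \<alpha> \<rho> y x = m * (exp (- \<alpha> * (dist y x)^2) - exp (- \<alpha> * \<rho>^2))"

lemma C2_barrier:
  fixes y :: "real^'n::finite"
  shows "C2_on UNIV (barrier m \<alpha> \<rho> y)"
    and "laplacian (barrier m \<alpha> \<rho> y) x
      = m * (4 * \<alpha>^2 * (dist y x)^2 - 2 * \<alpha> * CARD('n)) * exp (- \<alpha> * (dist y x)^2)"
proof -
  define q where "q x = (x - y) \<bullet> (x - y)" for x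
  define E where "E x = exp (- \<alpha> * q x)" for x
  have dq: "(dist y x)^2 = q x" for x
    unfolding dist_commute[of y] by (simp add: q_def dist_norm power2_norm_eq_inner)
  have bar: "barrier m \<alpha> \<rho> y = (\<lambda>x. m * (exp (- \<alpha> * q x) - exp (- \<alpha> * \<rho>^2)))"
    by (rule ext) (simp add: barrier_def dq)
  have hq: "(q has_derivative (\<lambda>v. 2 * ((x - y) \<bullet> v))) (at x)" for x
    unfolding q_def by (auto intro!: derivative_eq_intros simp: inner_commute)
  have q: "q differentiable (at x)" "pd i q x = 2 * (x - y)$i" for x i
    using differentiableI[OF hq] pd_eqI[OF hq] by (auto simp: inner_axis)
  have hl: "((\<lambda>x. c * (x - y)$i) has_derivative (\<lambda>v. c * v$i)) (at x)" for x :: "real^'n" and i c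
    unfolding vector_minus_component
    by (rule derivative_eq_intros bounded_linear_imp_has_derivative[OF bounded_linear_vec_nth] HOL.refl)+ simp
  have l: "(\<lambda>x. c * (x - y)$i) differentiable (at x)" "pd j (\<lambda>x. c * (x - y)$i) x = (if i = j then c else 0)"
    for x i j c
    using differentiableI[OF hl] pd_eqI[OF hl[of c i x], of j] by (auto simp: axis_def)
  have E: "E differentiable (at x)" "pd i E x = - 2 * \<alpha> * (x - y)$i * E x" for x i
  proof -
    have d: "((\<lambda>s. exp (- \<alpha> * s)) has_real_derivative - \<alpha> * E x) (at (q x))"
      by (auto intro!: derivative_eq_intros simp: E_def)
    show "E differentiable (at x)" "pd i E x = - 2 * \<alpha> * (x - y)$i * E x"
      using pd_chain[OF d q(1)] unfolding E_def[symmetric] q(2) by auto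
  qed
  have b: "barrier m \<alpha> \<rho> y differentiable (at x)" "pd i (barrier m \<alpha> \<rho> y) x = (- 2 * \<alpha> * m * (x - y)$i) * E x" for x i
  proof -
    have d: "((\<lambda>s. m * (exp (- \<alpha> * s) - exp (- \<alpha> * \<rho>^2))) has_real_derivative - \<alpha> * m * E x) (at (q x))"
      by (auto intro!: derivative_eq_intros simp: E_def)
    show "barrier m \<alpha> \<rho> y differentiable (at x)" "pd i (barrier m \<alpha> \<rho> y) x = (- 2 * \<alpha> * m * (x - y)$i) * E x"
      using pd_chain[OF d q(1)] unfolding bar q(2) by auto
  qed
  then have b': "pd i (barrier m \<alpha> \<rho> y) = (\<lambda>x. (- 2 * \<alpha> * m * (x - y)$i) * E x)" for i by blast
  have bb: "pd j (pd i (barrier m \<alpha> \<rho> y)) x = (- 2 * \<alpha> * m * (x - y)$i) * (- 2 * \<alpha> * (x - y)$j * E x)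
      + (if i = j then - 2 * \<alpha> * m else 0) * E x" for i j x
    unfolding b' by (simp only: pd_mult[OF l(1) E(1)] E(2) l(2))
  have cE: "continuous_on UNIV E"
    by (intro continuous_at_imp_continuous_on ballI differentiable_imp_continuous_within E)
  show "C2_on UNIV (barrier m \<alpha> \<rho> y)"
  proof (rule C2_onI)
    show "pd i (barrier m \<alpha> \<rho> y) differentiable at x" for i x
      unfolding b' by (intro differentiable_mult l E)
    show "continuous_on UNIV (pd j (pd i (barrier m \<alpha> \<rho> y)))" for i j
      unfolding bb[abs_def] by (intro continuous_intros cE)
  qed (use b in auto)
  have "(\<Sum>i\<in>UNIV. ((x - y)$i)^2) = q x" by (simp add: q_def inner_vec_def power2_eq_square)
  moreover have "laplacian (barrier m \<alpha> \<rho> y) x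
      = 4 * \<alpha>^2 * m * E x * (\<Sum>i\<in>UNIV. ((x - y)$i)^2) - 2 * \<alpha> * m * E x * CARD('n)"
    unfolding laplacian_def bb by (simp add: sum.distrib sum_subtractf sum_negf sum_distrib_left power2_eq_square algebra_simps)
  ultimately show "laplacian (barrier m \<alpha> \<rho> y) x
      = m * (4 * \<alpha>^2 * (dist y x)^2 - 2 * \<alpha> * CARD('n)) * exp (- \<alpha> * (dist y x)^2)"
    unfolding dq by (simp add: E_def algebra_simps)
qed

text \<open>With n the dimension, this expression is the factor in the Laplacian of the barrier at
  distance \<epsilon> from its centre. It grows quadratically in \<alpha> and so exceeds any given
  K.\<close>

lemma barrier_exponent_exists:
  assumes "\<epsilon> > (0::real)"
  shows "\<exists>\<alpha>>0. K < 4 * \<alpha>^2 * \<epsilon>^2 - 2 * \<alpha> * n"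
proof -
  have "\<epsilon>^2 > 0" using assms by simp
  define \<alpha> where "\<alpha> = (\<bar>n\<bar> + \<bar>K\<bar>) / \<epsilon>^2 + 1"
  have a: "\<alpha> \<ge> 1" by (simp add: \<alpha>_def)
  have "\<alpha> * \<epsilon>^2 = \<bar>n\<bar> + \<bar>K\<bar> + \<epsilon>^2" using assms by (simp add: \<alpha>_def field_simps)
  then have b: "2 * \<alpha> * \<epsilon>^2 - n > \<bar>K\<bar>" using \<open>\<epsilon>^2 > 0\<close> by linarith
  have "\<bar>K\<bar> < 1 * (2 * \<alpha> * \<epsilon>^2 - n)" using b by simp
  also have "\<dots> \<le> (2 * \<alpha>) * (2 * \<alpha> * \<epsilon>^2 - n)" using a b by (intro mult_right_mono) auto
  also have "\<dots> = 4 * \<alpha>^2 * \<epsilon>^2 - 2 * \<alpha> * n" by (simp add: power2_eq_square algebra_simps)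
  finally show ?thesis using a by (intro exI[of _ \<alpha>]) auto
qed

text \<open>The barrier is at most m <= w on the inner ball and 0 <= w on the outer sphere. A
  negative minimum of z = w - barrier would thus lie in the open shell, where the Laplacian of z is
  below K z <= 0, contradicting the second derivative test.\<close>

lemma barrier_le:
  fixes w :: "real^'n::finite \<Rightarrow> real"
  assumes D: "open D" "C2_on D w" "cball y \<rho> \<subseteq> D"
    and w: "\<And>x. x \<in> cball y \<rho> \<Longrightarrow> w x \<ge> 0" "\<And>x. x \<in> ball y \<rho> \<Longrightarrow> laplacian w x \<le> K * w x"
      "\<And>x. x \<in> cball y \<epsilon> \<Longrightarrow> w x \<ge> m"
    and c: "0 \<le> K" "0 < \<epsilon>" "0 \<le> m" "0 < \<alpha>" "K < 4 * \<alpha>^2 * \<epsilon>^2 - 2 * \<alpha> * CARD('n)"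
    and x: "x \<in> cball y \<rho>"
  shows "barrier m \<alpha> \<rho> y x \<le> w x"
proof (rule ccontr)
  assume neg: "\<not> barrier m \<alpha> \<rho> y x \<le> w x"
  let ?h = "barrier m \<alpha> \<rho> y"
  define z where "z x = w x - ?h x" for x
  \<comment> \<open>For m = 0 the barrier is identically 0 and the claim is just w >= 0; the strict
    inequality for the Laplacian below needs m > 0.\<close>
  have "m \<noteq> 0" using neg w(1)[OF x] by (auto simp: barrier_def)
  then have m: "m > 0" using c by simp
  have hm: "?h x \<le> m" for x
  proof -
    have "exp (- \<alpha> * (dist y x)^2) \<le> 1" using c by simp
    then have "exp (- \<alpha> * (dist y x)^2) - exp (- \<alpha> * \<rho>^2) \<le> 1" using exp_gt_zero[of "- \<alpha> * \<rho>^2"] by linarith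
    then show ?thesis using m by (simp add: barrier_def)
  qed
  define N where "N = cball y \<rho> - ball y \<epsilon>"
  have cpt: "compact N" unfolding N_def by (intro compact_diff) auto
  have zx: "z x < 0" using neg by (simp add: z_def)
  have zball: "z x \<ge> 0" if "x \<in> cball y \<epsilon>" for x using w(3)[OF that] hm[of x] by (simp add: z_def)
  then have "x \<notin> cball y \<epsilon>" using zx by force
  then have xN: "x \<in> N" using x by (simp add: N_def)
  have zD: "C2_on D z"
    unfolding z_def by (rule C2_on_diff(1)[OF D(1,2) C2_on_subset[OF C2_barrier(1) subset_UNIV]])
  have "continuous_on N z"
    by (rule continuous_on_subset[OF C2_onD(3)[OF zD D(1)]]) (use D in \<open>auto simp: N_def\<close>)
  then obtain x0 where x0: "x0 \<in> N" "\<And>v. v \<in> N \<Longrightarrow> z x0 \<le> z v"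
    using continuous_attains_inf[OF cpt] xN by blast
  have z0: "z x0 < 0" using x0(2)[OF xN] zx by simp
  have 1: "x0 \<notin> cball y \<epsilon>" using zball[of x0] z0 by auto
  have "dist y x0 \<noteq> \<rho>"
  proof
    assume "dist y x0 = \<rho>"
    then have "?h x0 = 0" by (simp add: barrier_def)
    then show False using z0 w(1)[of x0] x0(1) by (simp add: z_def N_def)
  qed
  then have 2: "x0 \<in> ball y \<rho>" using x0(1) by (auto simp: N_def)
  have "open (ball y \<rho> - cball y \<epsilon>)" by (intro open_Diff) auto
  then obtain r where r: "r > 0" "ball x0 r \<subseteq> ball y \<rho> - cball y \<epsilon>"
    using 1 2 open_contains_ball by (metis DiffI)
  have "ball x0 r \<subseteq> N" using r(2) unfolding N_def by force
  then have lz: "laplacian z x0 \<ge> 0"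
    using laplacian_nonneg_at_min[OF D(1) zD _ r(1)] x0(2) 2 D(3) by (auto simp: subset_eq)
  have lz': "laplacian z x0 = laplacian w x0 - laplacian ?h x0"
    unfolding z_def
    by (rule C2_on_diff(2)[OF D(1,2) C2_on_subset[OF C2_barrier(1) subset_UNIV]]) (use 2 D(3) in auto)
  let ?E = "exp (- \<alpha> * (dist y x0)^2)"
  have "\<epsilon>^2 \<le> (dist y x0)^2" using 1 c by (intro power_mono) auto
  then have "4 * \<alpha>^2 * \<epsilon>^2 \<le> 4 * \<alpha>^2 * (dist y x0)^2" by (intro mult_left_mono) auto
  then have "K < 4 * \<alpha>^2 * (dist y x0)^2 - 2 * \<alpha> * CARD('n)" using c(5) by linarith
  then have "(m * ?E) * K < (m * ?E) * (4 * \<alpha>^2 * (dist y x0)^2 - 2 * \<alpha> * CARD('n))"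
    using m by (intro mult_strict_left_mono) auto
  moreover have "laplacian ?h x0 = (m * ?E) * (4 * \<alpha>^2 * (dist y x0)^2 - 2 * \<alpha> * CARD('n))"
    unfolding C2_barrier(2) by simp
  moreover have "K * ?h x0 \<le> (m * ?E) * K"
  proof -
    have "?h x0 \<le> m * ?E" using m by (simp add: barrier_def)
    then show ?thesis using c(1) by (metis mult.commute mult_left_mono)
  qed
  ultimately have "laplacian z x0 < K * z x0"
    using w(2)[OF 2] lz' by (simp add: z_def algebra_simps)
  moreover have "K * z x0 \<le> 0" using c(1) z0 by (simp add: mult_nonneg_nonpos)
  ultimately show False using lz by simp
qed

lemma positive_near:
  fixes w :: "'a::metric_space \<Rightarrow> real"
  assumes "open D" "continuous_on D w" "y \<in> D" "w y > 0"
  obtains \<epsilon> where "\<epsilon> > 0" "\<And>x. x \<in> cball y \<epsilon> \<Longrightarrow> w x \<ge> w y / 2"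
proof -
  have "open (D \<inter> w -` {w y / 2<..})" using continuous_open_preimage[OF assms(2,1)] by simp
  moreover have "y \<in> D \<inter> w -` {w y / 2<..}" using assms(3,4) by simp
  ultimately obtain \<epsilon> where "\<epsilon> > 0" "cball y \<epsilon> \<subseteq> D \<inter> w -` {w y / 2<..}"
    using open_contains_cball by blast
  then show thesis by (intro that[of \<epsilon>]) (auto simp: subset_eq less_imp_le)
qed

text \<open>The barrier is centred at y, continuity supplies the inner ball with m = w y / 2, and
  the barrier is positive on the whole open ball.\<close>

lemma positivity_spreads:
  fixes w :: "real^'n::finite \<Rightarrow> real"
  assumes D: "open D" "C2_on D w" "cball y \<rho> \<subseteq> D"
    and w: "\<And>x. x \<in> D \<Longrightarrow> w x \<ge> 0" "\<And>x. x \<in> D \<Longrightarrow> laplacian w x \<le> K * w x"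
    and K: "0 \<le> K" and y: "w y > 0" and x: "x \<in> ball y \<rho>"
  shows "w x > 0"
proof -
  have \<rho>: "\<rho> > 0" using x by (auto intro: le_less_trans[OF zero_le_dist])
  then have yD: "y \<in> D" using D(3) by auto
  have cw: "continuous_on D w" by (rule C2_onD(3)[OF D(2,1)])
  obtain \<epsilon> where \<epsilon>: "\<epsilon> > 0" and lo: "\<And>x. x \<in> cball y \<epsilon> \<Longrightarrow> w x \<ge> w y / 2"
    using positive_near[where w = w, OF D(1) cw yD y] by blast
  obtain \<alpha> where \<alpha>: "\<alpha> > 0" "K < 4 * \<alpha>^2 * \<epsilon>^2 - 2 * \<alpha> * CARD('n)"
    using barrier_exponent_exists[OF \<epsilon>] by blast
  have "barrier (w y / 2) \<alpha> \<rho> y x \<le> w x"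
    by (rule barrier_le[OF D _ _ lo K \<epsilon> _ \<alpha>]) (use w y x D(3) in \<open>auto simp: subset_eq\<close>)
  moreover have "barrier (w y / 2) \<alpha> \<rho> y x > 0"
  proof -
    have "(dist y x)^2 < \<rho>^2" using x by (intro power_strict_mono) auto
    then show ?thesis using \<alpha>(1) y by (simp add: barrier_def)
  qed
  ultimately show ?thesis by simp
qed

text \<open>The zero set of w in \<open>D\<close> is open, just as the positivity set, so a
  connected set cannot meet both. Connectedness is asked of \<open>C\<close> so that the lemma can
  be applied along a single segment.\<close>

lemma strong_max_principle:
  fixes w :: "real^'n::finite \<Rightarrow> real"
  assumes D: "open D" "C2_on D w"
    and w: "\<And>x. x \<in> D \<Longrightarrow> w x \<ge> 0" "\<And>x. x \<in> D \<Longrightarrow> laplacian w x \<le> K * w x"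
    and K: "0 \<le> K" and C: "connected C" "C \<subseteq> D" "a \<in> C" "w a > 0" "x \<in> C"
  shows "w x > 0"
proof (rule ccontr)
  assume "\<not> w x > 0"
  then have wx: "w x = 0" using w(1)[of x] C by force
  have cw: "continuous_on D w" by (rule C2_onD(3)[OF D(2,1)])
  let ?P = "{x \<in> D. w x > 0}" and ?Q = "{x \<in> D. w x = 0}"
  have "?P = D \<inter> w -` {0<..}" by auto
  then have P: "open ?P" using continuous_open_preimage[OF cw D(1)] by simp
  have Q: "open ?Q"
    unfolding open_contains_ball
  proof
    fix v assume v: "v \<in> ?Q"
    then obtain r where r: "r > 0" "cball v r \<subseteq> D" using D(1) open_contains_cball by blast
    \<comment> \<open>The radii fit because r/3 < r/2 puts v into the ball about t, and r/3 + r/2 <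
      r keeps that ball inside \<open>D\<close>.\<close>
    have "w t = 0" if t: "t \<in> ball v (r / 3)" for t
    proof (rule ccontr)
      assume "w t \<noteq> 0"
      have tD: "t \<in> D" using t r by (auto simp: subset_eq)
      have sub: "cball t (r / 2) \<subseteq> D"
      proof
        fix s assume "s \<in> cball t (r / 2)"
        then have "dist v s \<le> r" using dist_triangle[of v s t] t r(1) by auto
        then show "s \<in> D" using r(2) by auto
      qed
      have "w v > 0"
        by (rule positivity_spreads[OF D sub w K]) (use \<open>w t \<noteq> 0\<close> w(1)[OF tD] t r(1) zero_le_dist[of t v] in \<open>auto simp: dist_commute simp del: zero_le_dist\<close>)
      then show False using v by simp
    qed
    then show "\<exists>e>0. ball v e \<subseteq> ?Q" using r by (intro exI[of _ "r / 3"]) (auto simp: subset_eq)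
  qed
  have "C \<subseteq> ?P \<union> ?Q" using C(2) w(1) by force
  moreover have "?P \<inter> ?Q \<inter> C = {}" by auto
  ultimately have "?P \<inter> C = {} \<or> ?Q \<inter> C = {}" using connectedD[OF C(1) P Q] by blast
  then show False using C wx by auto
qed

text \<open>The point p lies on the sphere about y, where w and the barrier both vanish. Along the
  radius w stays above the barrier, so its slope at p is at least that of the barrier, and this
  slope is explicit enough to be uniform in p and w.\<close>

lemma quantitative_hopf:
  fixes w :: "real^'n::finite \<Rightarrow> real" and p :: "real^'n"
  assumes y: "y = p + \<rho> *\<^sub>R axis i 1" and \<rho>: "\<rho> > 0"
    and D: "open D" "C2_on D w" "cball y \<rho> \<subseteq> D"
    and w: "\<And>x. x \<in> cball y \<rho> \<Longrightarrow> w x \<ge> 0" "\<And>x. x \<in> ball y \<rho> \<Longrightarrow> laplacian w x \<le> K * w x"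
      "\<And>x. x \<in> cball y \<epsilon> \<Longrightarrow> w x \<ge> m"
    and c: "0 \<le> K" "0 < \<epsilon>" "0 \<le> m" "0 < \<alpha>" "K < 4 * \<alpha>^2 * \<epsilon>^2 - 2 * \<alpha> * CARD('n)"
    and p: "w p = 0"
  shows "m * (2 * \<alpha> * \<rho> * exp (- \<alpha> * \<rho>^2)) \<le> pd i w p"
proof (rule ccontr)
  assume neg: "\<not> m * (2 * \<alpha> * \<rho> * exp (- \<alpha> * \<rho>^2)) \<le> pd i w p"
  let ?p = "\<lambda>t. p + t *\<^sub>R axis i (1::real)"
  have dist: "dist y (?p t) = \<bar>\<rho> - t\<bar>" for t
  proof -
    have "y - ?p t = (\<rho> - t) *\<^sub>R axis i 1" by (simp add: y algebra_simps)
    then show ?thesis by (simp add: dist_norm)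
  qed
  have pD: "p \<in> D" using dist[of 0] D(3) \<rho> by (auto simp: subset_eq)
  define b where "b t = m * (exp (- \<alpha> * (\<rho> - t)^2) - exp (- \<alpha> * \<rho>^2))" for t
  have db: "(b has_real_derivative m * (2 * \<alpha> * \<rho> * exp (- \<alpha> * \<rho>^2))) (at 0)"
    unfolding b_def by (auto intro!: derivative_eq_intros)
  have dw: "((\<lambda>t. w (?p t)) has_real_derivative pd i w p) (at 0)"
    using pd_line[where t = 0 and g = w and x = p and i = i] C2_onD(1)[OF D(2,1) pD] by simp
  obtain e where e: "e > 0" "\<And>h. 0 < h \<Longrightarrow> h < e \<Longrightarrow> w (?p (0 + h)) - b (0 + h) < w (?p 0) - b 0"
    using DERIV_neg_dec_right[OF DERIV_diff[OF dw db]] neg by auto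
  define h where "h = min e \<rho> / 2"
  have h: "0 < h" "h < e" "h < \<rho>" using e(1) \<rho> by (auto simp: h_def)
  have "barrier m \<alpha> \<rho> y (?p h) \<le> w (?p h)"
    by (rule barrier_le[OF D w c]) (use dist[of h] h in auto)
  moreover have "barrier m \<alpha> \<rho> y (?p h) = b h" by (simp add: barrier_def b_def dist)
  moreover have "w (?p h) - b h < w (?p 0) - b 0" using e(2)[OF h(1,2)] by simp
  moreover have "w (?p 0) - b 0 = 0" using p by (simp add: b_def)
  ultimately show False by simp
qed

section \<open>Monotonicity and the Hessian at the origin\<close>

context stable_solution
begin

definition cap_diff :: "'n \<Rightarrow> real \<Rightarrow> real^'n \<Rightarrow> real" where
  "cap_diff i c x = u (refl_at i c x) - u x"

lemma open_cap_dom: "open (\<Omega> \<inter> refl_at i c -` \<Omega>)"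
  using open_dom open_refl_at_vimage by blast

lemma cap_diff_C2: "C2_on (\<Omega> \<inter> refl_at i c -` \<Omega>) (cap_diff i c)"
proof -
  have "C2_on (refl_at i c -` \<Omega>) (\<lambda>x. u (refl_at i c x))"
    by (rule C2_on_refl_at(1)[OF open_dom u_C2])
  then show ?thesis unfolding cap_diff_def
    by (intro C2_on_diff(1)[OF open_cap_dom] C2_on_subset[OF _ Int_lower2] C2_on_subset[OF u_C2 Int_lower1])
qed

lemma K_nonneg: "x \<in> \<Omega> \<Longrightarrow> K \<ge> 0"
  using f'_u_bound[of x] by linarith

text \<open>The potential has no sign, but once the difference is known to be nonnegative, its
  negative may be replaced by the constant \<open>K\<close>, the form that the barrier arguments
  require.\<close>

lemma cap_in:
  assumes "c \<ge> 0" "x \<in> \<Omega>" "x$i \<ge> c"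
  shows "x \<in> \<Omega> \<inter> refl_at i c -` \<Omega>" "cap_diff i c x \<ge> 0" "laplacian (cap_diff i c) x \<le> K * cap_diff i c x"
proof -
  have R: "refl_at i c x \<in> \<Omega>" using refl_at_dom[of 1 c x i] assms by simp
  then show "x \<in> \<Omega> \<inter> refl_at i c -` \<Omega>" using assms by simp
  show n: "cap_diff i c x \<ge> 0"
  proof (cases "x$i = c")
    case True
    then have "refl_at i c x = x" by (simp add: vec_eq_iff)
    then show ?thesis by (simp add: cap_diff_def)
  next
    case False
    then show ?thesis using cap_comparison[of 1 c x i] assms by (simp add: cap_diff_def)
  qed
  have "laplacian (cap_diff i c) x \<le> - f' (u x) * cap_diff i c x"
    using laplacian_refl_diff(1,3)[OF assms(2) R] by (simp add: cap_diff_def[abs_def])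
  also have "\<dots> \<le> K * cap_diff i c x"
    using f'_u_bound[OF assms(2)] by (intro mult_right_mono n) linarith
  finally show "laplacian (cap_diff i c) x \<le> K * cap_diff i c x" .
qed

text \<open>Going from \<open>p\<close> in direction \<open>x\<^sub>i\<close>, one meets the boundary of the domain at a point whose mirror image
  is interior, so \<open>cap_diff\<close> is positive near that end of the ray.\<close>
lemma cap_diff_pos_somewhere:
  assumes p: "p \<in> \<Omega>" "p$i = c" "c > 0"
  obtains t where "t > 0" "p + t *\<^sub>R axis i 1 \<in> \<Omega>" "cap_diff i c (p + t *\<^sub>R axis i 1) > 0"
proof -
  let ?p = "\<lambda>t. p + t *\<^sub>R axis i (1::real)"
  define T where "T = {t. t \<ge> 0 \<and> ?p t \<in> \<Omega>}"
  have T0: "0 \<in> T" using p by (simp add: T_def)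
  obtain R where R: "\<And>x. x \<in> \<Omega> \<Longrightarrow> norm x \<le> R" using bounded_dom unfolding bounded_iff by blast
  have "t \<le> R" if "t \<in> T" for t
  proof -
    have "\<bar>(?p t)$i\<bar> \<le> R" using component_le_norm_cart[of "?p t" i] R[of "?p t"] that by (simp add: T_def)
    then show ?thesis using p by (simp add: axis_def)
  qed
  then have bT: "bdd_above T" by (auto simp: bdd_above_def)
  define a where "a = Sup T"
  have a: "t \<le> a" if "t \<in> T" for t unfolding a_def using that bT by (rule cSup_upper)
  have a0: "a \<ge> 0" using a[OF T0] .
  have near: "\<exists>t\<in>T. s < t" if "s < a" for s
    using that T0 bT less_cSup_iff[of T s] unfolding a_def by blast
  have out: "?p a \<notin> \<Omega>"
  proof
    assume "?p a \<in> \<Omega>"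
    then obtain e where e: "e > 0" "cball (?p a) e \<subseteq> \<Omega>" using open_dom open_contains_cball by blast
    have "dist (?p a) (?p (a + e)) = e" using e(1) by (simp add: dist_norm algebra_simps)
    then have "?p (a + e) \<in> \<Omega>" using e by (auto simp: subset_eq)
    then have "a + e \<in> T" using a0 e by (simp add: T_def)
    then show False using a e by force
  qed
  have ap: "a > 0" using out p(1) a0 by (cases "a = 0") auto
  \<comment> \<open>The mirror image has i-th coordinate c - a. It lies between p and the reflection
    of \<open>?p t\<close> in x_i = 0, whose coordinate is -(c + t), once t > a - 2c; such t in
    \<open>T\<close> exist because c > 0.\<close>
  have mirror: "refl_at i c (?p a) \<in> \<Omega>"
  proof -
    obtain t where t: "t \<in> T" "a - 2 * c < t" using near[of "a - 2 * c"] p by auto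
    have "?p t \<in> \<Omega>" using t by (simp add: T_def)
    from refl_dom[OF this, of i] show ?thesis
      by (rule coord_convexD[OF convex_dom _ p(1)]) (use t p a0 in \<open>auto simp: axis_def\<close>)
  qed
  define W where "W x = U (refl_at i c x) - U x" for x
  have "continuous_on UNIV W"
    unfolding W_def by (intro continuous_intros U_continuous continuous_on_compose2[OF U_continuous]) auto
  then have "continuous_on UNIV (\<lambda>t. W (?p t))"
    by (rule continuous_on_compose2) (auto intro!: continuous_intros)
  moreover have "W (?p a) > 0" using mirror out by (simp add: W_def U_in U_out u_pos)
  ultimately obtain e where e: "e > 0" "\<And>t. t \<in> cball a e \<Longrightarrow> W (?p t) \<ge> W (?p a) / 2"
    using positive_near[of UNIV "\<lambda>t. W (?p t)" a] by auto
  obtain t where t: "t \<in> T" "max 0 (a - e) < t" using near[of "max 0 (a - e)"] ap e(1) by auto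
  then have tt: "t > 0" "?p t \<in> \<Omega>" "t \<in> cball a e" using a[OF t(1)] by (auto simp: T_def dist_real_def)
  have "refl_at i c (?p t) \<in> \<Omega>"
    using cap_in(1)[of c "?p t" i] tt p by (auto simp: axis_def)
  then have "W (?p t) = cap_diff i c (?p t)" using tt by (simp add: W_def cap_diff_def U_in)
  then show thesis using that[of t] tt e(2)[OF tt(3)] \<open>W (?p a) > 0\<close> by simp
qed

text \<open>The positive point found on the ray and the given point are joined by a piece of the
  same ray, which stays in the cap by convexity along the axis; the strong maximum principle acts
  along this segment.\<close>

lemma cap_diff_pos:
  assumes p: "p \<in> \<Omega>" "p$i = c" "c > 0" and t: "t > 0" "p + t *\<^sub>R axis i 1 \<in> \<Omega>"
  shows "cap_diff i c (p + t *\<^sub>R axis i 1) > 0"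
proof -
  let ?p = "\<lambda>t. p + t *\<^sub>R axis i (1::real)"
  obtain s where s: "s > 0" "?p s \<in> \<Omega>" "cap_diff i c (?p s) > 0"
    by (rule cap_diff_pos_somewhere[OF p])
  define D where "D = \<Omega> \<inter> {x. c < x$i}"
  have D: "open D" unfolding D_def
    using open_dom by (intro open_Int open_Collect_less continuous_intros)
  have sub: "D \<subseteq> \<Omega> \<inter> refl_at i c -` \<Omega>"
    using cap_in(1)[of c] p by (force simp: D_def)
  define C where "C = ?p ` closed_segment s t"
  have C: "connected C" unfolding C_def
    by (intro connected_continuous_image continuous_intros connected_segment)
  have CD: "C \<subseteq> D"
  proof
    fix x assume "x \<in> C"
    then obtain r where r: "x = ?p r" "r \<in> closed_segment s t" by (auto simp: C_def)
    then have "min s t \<le> r" "r \<le> max s t" by (auto simp: closed_segment_eq_real_ivl split: if_splits)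
    moreover from this have "?p r \<in> \<Omega>"
      using s t by - (rule coord_convexD[OF convex_dom, of "?p (min s t)" "?p (max s t)" i],
        auto simp: axis_def min_def max_def)
    ultimately show "x \<in> D" using r s t p by (auto simp: D_def axis_def)
  qed
  have w: "cap_diff i c x \<ge> 0" "laplacian (cap_diff i c) x \<le> K * cap_diff i c x" if "x \<in> D" for x
    using cap_in(2,3)[of c x i] p that by (auto simp: D_def)
  have "?p s \<in> C" "?p t \<in> C" by (auto simp: C_def)
  then show ?thesis
    using strong_max_principle[OF D C2_on_subset[OF cap_diff_C2 sub] w K_nonneg[OF p(1)] C CD _ s(3)] by blast
qed

text \<open>This is the ball for Hopf's lemma: it touches the plane x_i = c at p from the side of
  the cap.\<close>

lemma cap_ball:
  assumes p: "p \<in> \<Omega>" "p$i = c" "c > 0" and \<rho>: "\<rho> > 0" "cball p (2 * \<rho>) \<subseteq> \<Omega>"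
    and x: "x \<in> cball (p + \<rho> *\<^sub>R axis i 1) \<rho>"
  shows "x \<in> \<Omega>" "x$i \<ge> c"
proof -
  let ?y = "p + \<rho> *\<^sub>R axis i (1::real)"
  have "dist p ?y = \<rho>" using \<rho> by (simp add: dist_norm)
  then have "dist p x \<le> 2 * \<rho>" using dist_triangle[of p x ?y] x by simp
  then show "x \<in> \<Omega>" using \<rho>(2) by auto
  have "\<bar>(?y - x)$i\<bar> \<le> \<rho>" using component_le_norm_cart[of "?y - x" i] x by (simp add: dist_norm)
  then show "x$i \<ge> c" using p by (simp add: axis_def)
qed

text \<open>\<open>cap_diff\<close> vanishes at p, and since the reflection reverses x_i its i-th
  derivative there is \<open>- 2 * pd i u p\<close>. A Hopf bound for the difference is thus a bound
  for \<open>u\<close> itself.\<close>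

lemma cap_hopf:
  assumes p: "p \<in> \<Omega>" "p$i = c" "c > 0" and \<rho>: "\<rho> > 0" "cball p (2 * \<rho>) \<subseteq> \<Omega>"
    and m: "\<And>x. x \<in> cball (p + \<rho> *\<^sub>R axis i 1) \<epsilon> \<Longrightarrow> m \<le> cap_diff i c x" "0 \<le> m" "0 < \<epsilon>"
    and \<alpha>: "0 < \<alpha>" "K < 4 * \<alpha>^2 * \<epsilon>^2 - 2 * \<alpha> * CARD('n)"
  shows "m * (2 * \<alpha> * \<rho> * exp (- \<alpha> * \<rho>^2)) \<le> - 2 * pd i u p"
proof -
  note B = cap_in[OF less_imp_le[OF p(3)] cap_ball[OF p \<rho>]]
  have rp: "refl_at i c p = p" using p by (simp add: vec_eq_iff)
  have du: "u differentiable (at p)" using C2_onD(1)[OF u_C2 open_dom p(1)] .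
  have "pd i (cap_diff i c) p = - 2 * pd i u p"
    using pd_diff[OF pd_refl_at(2)[of u i c p] du, of i] pd_refl_at(1)[of u i c p i] du
    by (simp add: rp cap_diff_def[abs_def])
  moreover have "m * (2 * \<alpha> * \<rho> * exp (- \<alpha> * \<rho>^2)) \<le> pd i (cap_diff i c) p"
  proof (rule quantitative_hopf[OF HOL.refl \<rho>(1) open_cap_dom cap_diff_C2 _ _ _ m(1) K_nonneg[OF p(1)] m(3,2) \<alpha>])
    show "cap_diff i c p = 0" by (simp add: cap_diff_def rp)
    show "cball (p + \<rho> *\<^sub>R axis i 1) \<rho> \<subseteq> \<Omega> \<inter> refl_at i c -` \<Omega>" using B(1) by blast
    show "laplacian (cap_diff i c) x \<le> K * cap_diff i c x" if "x \<in> ball (p + \<rho> *\<^sub>R axis i 1) \<rho>" for x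
      using B(3) that ball_subset_cball by blast
  qed (rule B(2))
  ultimately show ?thesis by simp
qed

lemma pd_u_neg:
  assumes p: "p \<in> \<Omega>" "p$i > 0"
  shows "pd i u p < 0"
proof -
  obtain r where r: "r > 0" "cball p r \<subseteq> \<Omega>" using open_dom p(1) open_contains_cball by blast
  define \<rho> where "\<rho> = r / 2"
  have \<rho>: "\<rho> > 0" "cball p (2 * \<rho>) \<subseteq> \<Omega>" using r by (auto simp: \<rho>_def)
  \<comment> \<open>The reflecting plane is taken through p itself, so each point gets its own
    cap.\<close>
  define c where "c = p$i"
  have c: "p$i = c" "c > 0" using p by (auto simp: c_def)
  define y where "y = p + \<rho> *\<^sub>R axis i (1::real)"
  have y: "y \<in> \<Omega>" "y$i \<ge> c" using cap_ball[OF p(1) c \<rho>, of y] \<rho>(1) by (auto simp: y_def)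
  have yp: "cap_diff i c y > 0" using cap_diff_pos[OF p(1) c \<rho>(1)] y by (simp add: y_def)
  obtain \<epsilon> where \<epsilon>: "\<epsilon> > 0" "\<And>x. x \<in> cball y \<epsilon> \<Longrightarrow> cap_diff i c x \<ge> cap_diff i c y / 2"
    using positive_near[OF open_cap_dom C2_onD(3)[OF cap_diff_C2 open_cap_dom] cap_in(1)[OF less_imp_le[OF c(2)] y] yp]
    by blast
  obtain \<alpha> where \<alpha>: "\<alpha> > 0" "K < 4 * \<alpha>^2 * \<epsilon>^2 - 2 * \<alpha> * CARD('n)"
    using barrier_exponent_exists[OF \<epsilon>(1)] by blast
  have "cap_diff i c y / 2 * (2 * \<alpha> * \<rho> * exp (- \<alpha> * \<rho>^2)) \<le> - 2 * pd i u p"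
    by (rule cap_hopf[OF p(1) c \<rho> _ _ \<epsilon>(1) \<alpha>]) (use \<epsilon> yp in \<open>auto simp: y_def\<close>)
  moreover have "cap_diff i c y / 2 * (2 * \<alpha> * \<rho> * exp (- \<alpha> * \<rho>^2)) > 0"
    using yp \<alpha> \<rho> by simp
  ultimately show ?thesis by linarith
qed

section \<open>Consequences of symmetry, and the Hessian at the origin\<close>

lemma pd_u_odd:
  assumes "x \<in> \<Omega>"
  shows "pd i u (refl_at i 0 x) = - pd i u x"
proof -
  have "pd i (\<lambda>x. u (refl_at i 0 x)) x = pd i u x"
    by (rule pd_cong[OF open_dom assms u_symmetric])
  then show ?thesis
    using pd_refl_at(1)[OF C2_onD(1)[OF u_C2 open_dom refl_dom[OF assms]], of i i] by simp
qed

lemma pd_u_hyperplane: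
  assumes "x \<in> \<Omega>" "x$i = 0"
  shows "pd i u x = 0"
proof -
  have "refl_at i 0 x = x" using assms by (simp add: vec_eq_iff)
  then show ?thesis using pd_u_odd[OF assms(1), of i] by simp
qed

lemma critical_point_eq_0:
  assumes "x \<in> \<Omega>" "critical_point u x"
  shows "x = 0"
proof -
  have "x$i = 0" for i
  proof (rule ccontr)
    assume "x$i \<noteq> 0"
    then consider "x$i > 0" | "(refl_at i 0 x)$i > 0" by fastforce
    then show False
    proof cases
      case 1
      then show False using pd_u_neg[OF assms(1)] assms(2) by (force simp: critical_point_def)
    next
      case 2
      then show False using pd_u_neg[OF refl_dom[OF assms(1)] 2] pd_u_odd[OF assms(1)] assms(2)
        by (force simp: critical_point_def)
    qed
  qed
  then show ?thesis by (simp add: vec_eq_iff)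
qed

text \<open>\<open>pd i u\<close> vanishes on the hyperplane x_i = 0, which contains the j-th axis,
  so its derivative along that axis is 0.\<close>

lemma hessian_off_diagonal:
  assumes "0 \<in> \<Omega>" "i \<noteq> j"
  shows "pd j (pd i u) 0 = 0"
proof -
  let ?p = "\<lambda>t. t *\<^sub>R axis j (1::real) :: real^'n"
  obtain r where r: "r > 0" "ball 0 r \<subseteq> \<Omega>" using open_dom assms(1) open_contains_ball by blast
  have "((\<lambda>t. pd i u (?p t)) has_real_derivative pd j (pd i u) 0) (at 0)"
    using pd_line[where t = 0 and g = "pd i u" and x = 0 and i = j] C2_onD(2)[OF u_C2 open_dom assms(1)] by simp
  moreover have "((\<lambda>t. pd i u (?p t)) has_real_derivative 0) (at 0)"
  proof (rule has_field_derivative_transform_within_open[where f = "\<lambda>_. 0" and S = "ball 0 r"])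
    fix t :: real assume "t \<in> ball 0 r"
    then have "?p t \<in> \<Omega>" using r by (auto simp: subset_eq)
    then show "0 = pd i u (?p t)" using pd_u_hyperplane[of "?p t" i] assms(2) by (simp add: axis_def)
  qed (use r in auto)
  ultimately show ?thesis by (rule DERIV_unique)
qed

text \<open>The Hopf constant in \<open>cap_hopf\<close> does not depend on the position \<open>c\<close> of the plane, and on a fixed inner
  ball \<open>cap_diff\<close> is at least of order \<open>c\<close>. Dividing by \<open>c\<close> and letting \<open>c \<rightarrow> 0\<close> gives the second derivative,
  without differentiating the equation.\<close>
lemma hessian_diagonal_neg:
  assumes "0 \<in> \<Omega>"
  shows "pd i (pd i u) 0 < 0"
proof -
  define e :: "real^'n" where "e = axis i 1"
  have e: "norm e = 1" "e$i = 1" by (auto simp: e_def)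
  obtain r where r: "r > 0" "cball 0 r \<subseteq> \<Omega>" using open_dom assms open_contains_cball by blast
  define \<rho> where "\<rho> = r / 4"
  have \<rho>: "\<rho> > 0" "cball 0 (4 * \<rho>) \<subseteq> \<Omega>" using r by (auto simp: \<rho>_def)
  \<comment> \<open>\<open>S\<close> contains every segment from x - 2c e to x used below, for all c
    <= \<rho>/8, yet stays away from x_i = 0. By compactness \<open>pd i u\<close> has a negative
    maximum -m on it.\<close>
  define S where "S = cball 0 (3 * \<rho>) \<inter> {x::real^'n. \<rho> / 4 \<le> x$i}"
  have "compact S" unfolding S_def
    by (intro compact_Int_closed compact_cball closed_Collect_le continuous_intros)
  moreover have S\<Omega>: "S \<subseteq> \<Omega>" using \<rho> by (auto simp: S_def)
  moreover have "\<rho> *\<^sub>R e \<in> S" using \<rho> e by (simp add: S_def)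
  moreover have "continuous_on S (pd i u)" using C2_onD(4)[OF u_C2 open_dom] S\<Omega> continuous_on_subset by blast
  ultimately obtain x1 where x1: "x1 \<in> S" "\<And>x. x \<in> S \<Longrightarrow> pd i u x \<le> pd i u x1"
    using continuous_attains_sup[of S "pd i u"] by blast
  define m where "m = - pd i u x1"
  have m: "m > 0" using pd_u_neg[of x1 i] x1(1) S\<Omega> \<rho> by (auto simp: m_def S_def)
  \<comment> \<open>The inner radius \<rho>/2, and with it \<alpha> and \<kappa>, is fixed before c
    is chosen.\<close>
  obtain \<alpha> where \<alpha>: "\<alpha> > 0" "K < 4 * \<alpha>^2 * (\<rho> / 2)^2 - 2 * \<alpha> * CARD('n)"
    using barrier_exponent_exists[of "\<rho> / 2" K "CARD('n)"] \<rho> by auto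
  define \<kappa> where "\<kappa> = 2 * \<alpha> * \<rho> * exp (- \<alpha> * \<rho>^2)"
  have \<kappa>: "\<kappa> > 0" using \<alpha> \<rho> by (simp add: \<kappa>_def)
  have main: "pd i u (c *\<^sub>R e) \<le> - (c * m * \<kappa>)" if c: "0 < c" "c \<le> \<rho> / 8" for c
  proof -
    have sub: "cball (c *\<^sub>R e) (2 * \<rho>) \<subseteq> cball 0 (4 * \<rho>)"
    proof
      fix x assume "x \<in> cball (c *\<^sub>R e) (2 * \<rho>)"
      moreover have "dist 0 (c *\<^sub>R e) = c" using c e by simp
      ultimately have "dist 0 x \<le> 4 * \<rho>" using dist_triangle[of 0 x "c *\<^sub>R e"] c \<rho>(1) by simp
      then show "x \<in> cball 0 (4 * \<rho>)" by simp
    qed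
    have "c *\<^sub>R e \<in> cball 0 (4 * \<rho>)" using c \<rho>(1) e by simp
    then have p: "c *\<^sub>R e \<in> \<Omega>" "(c *\<^sub>R e)$i = c" using \<rho>(2) e by auto
    \<comment> \<open>Reflecting in x_i = c and then in x_i = 0 is translation by -2c e. By symmetry
      of \<open>u\<close>, \<open>cap_diff i c x\<close> is therefore the drop of \<open>u\<close>
      from x - 2c e to x, and the mean value theorem on \<open>S\<close> bounds it below by 2c
      m.\<close>
    have low: "2 * c * m \<le> cap_diff i c x" if x: "x \<in> cball (c *\<^sub>R e + \<rho> *\<^sub>R axis i 1) (\<rho> / 2)" for x
    proof -
      let ?y = "c *\<^sub>R e + \<rho> *\<^sub>R e"
      have d: "norm (?y - x) \<le> \<rho> / 2" using x by (simp add: dist_norm e_def)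
      have "norm x \<le> norm ?y + norm (?y - x)" using norm_triangle_ineq4[of ?y "?y - x"] by simp
      moreover have "norm ?y = c + \<rho>" using c \<rho> e by (simp flip: scaleR_add_left)
      ultimately have nx: "norm x \<le> c + 3/2 * \<rho>" using d by simp
      have "\<bar>(?y - x)$i\<bar> \<le> \<rho> / 2" using component_le_norm_cart[of "?y - x" i] d by linarith
      moreover have "(?y - x)$i = c + \<rho> - x$i" using e by simp
      ultimately have xi: "x$i \<ge> c + \<rho> / 2" by linarith
      let ?q = "\<lambda>t. (x - (2 * c) *\<^sub>R e) + t *\<^sub>R axis i (1::real)"
      have qS: "?q t \<in> S" if "0 \<le> t" "t \<le> 2 * c" for t
      proof -
        have eq: "?q t = x - (2 * c - t) *\<^sub>R e" by (simp add: e_def algebra_simps)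
        have "norm (x - (2 * c - t) *\<^sub>R e) \<le> norm x + (2 * c - t)"
          using norm_triangle_ineq4[of x "(2 * c - t) *\<^sub>R e"] e that by simp
        then have 1: "norm (?q t) \<le> 3 * \<rho>" unfolding eq using nx that c by linarith
        have "(?q t)$i = x$i - (2 * c - t)" unfolding eq using e by simp
        then have "\<rho> / 4 \<le> (?q t)$i" using xi that c by linarith
        with 1 show ?thesis unfolding S_def mem_Collect_eq Int_iff mem_cball dist_0_norm by blast
      qed
      have "((\<lambda>t. u (?q t)) has_real_derivative pd i u (?q t)) (at t)" if "0 \<le> t" "t \<le> 2 * c" for t
        by (rule pd_line) (use qS[OF that] S\<Omega> C2_onD(1)[OF u_C2 open_dom] in blast)
      then obtain \<xi> where \<xi>: "0 < \<xi>" "\<xi> < 2 * c" "u (?q (2 * c)) - u (?q 0) = (2 * c - 0) * pd i u (?q \<xi>)"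
        using MVT2[of 0 "2 * c" "\<lambda>t. u (?q t)" "\<lambda>t. pd i u (?q t)"] c by auto
      have "pd i u (?q \<xi>) \<le> - m" using x1(2)[OF qS] \<xi> by (simp add: m_def)
      then have "(2 * c) * pd i u (?q \<xi>) \<le> (2 * c) * (- m)" using c by (intro mult_left_mono) auto
      moreover have "u (?q (2 * c)) = u x" by (simp add: e_def)
      moreover have q0: "?q 0 = refl_at i 0 (refl_at i c x)" by (simp add: vec_eq_iff e_def axis_def)
      moreover have "u (?q 0) = u (refl_at i c x)"
      proof -
        have "?q 0 \<in> \<Omega>" using qS[of 0] c S\<Omega> by auto
        then show ?thesis using u_symmetric[of "?q 0" i] unfolding q0 by simp
      qed
      ultimately show ?thesis using \<xi>(3) unfolding cap_diff_def diff_zero mult_minus_right by linarith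
    qed
    have "(2 * c * m) * \<kappa> \<le> - 2 * pd i u (c *\<^sub>R e)" unfolding \<kappa>_def
      by (rule cap_hopf[OF p c(1) \<rho>(1) subset_trans[OF sub \<rho>(2)] low _ _ \<alpha>]) (use c m \<rho> in auto)
    then show ?thesis by linarith
  qed
  have "((\<lambda>t. pd i u (t *\<^sub>R e)) has_real_derivative pd i (pd i u) 0) (at 0)"
    using pd_line[where t = 0 and g = "pd i u" and x = 0 and i = i] C2_onD(2)[OF u_C2 open_dom assms]
    by (simp add: e_def)
  then have "((\<lambda>t. pd i u (t *\<^sub>R e) / t) \<longlongrightarrow> pd i (pd i u) 0) (at 0)"
    using pd_u_hyperplane[OF assms, of i] by (simp add: has_field_derivative_iff)
  then have lim: "((\<lambda>t. pd i u (t *\<^sub>R e) / t) \<longlongrightarrow> pd i (pd i u) 0) (at_right 0)"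
    by (rule filterlim_mono) (auto simp: at_le)
  have "\<forall>\<^sub>F t in at_right 0. t \<in> {0<..<\<rho> / 8}"
    using \<rho> by (intro eventually_at_right_real) auto
  then have "\<forall>\<^sub>F t in at_right 0. pd i u (t *\<^sub>R e) / t \<le> - (m * \<kappa>)"
  proof eventually_elim
    case (elim t)
    then show ?case using main[of t] by (simp add: divide_le_eq algebra_simps)
  qed
  from tendsto_upperbound[OF lim this] have "pd i (pd i u) 0 \<le> - (m * \<kappa>)" by simp
  then show ?thesis using m \<kappa> mult_pos_pos[of m \<kappa>] by linarith
qed

text \<open>The maximum over the compact closure is positive, while \<open>u\<close> is 0 on the
  frontier, so it is attained inside.\<close>

lemma maximum_exists:
  assumes "\<Omega> \<noteq> {}"
  obtains x where "x \<in> \<Omega>" "\<And>y. y \<in> \<Omega> \<Longrightarrow> u y \<le> u x" "critical_point u x"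
proof -
  have "compact (closure \<Omega>)" "closure \<Omega> \<noteq> {}" using bounded_dom assms by auto
  then obtain x where x: "x \<in> closure \<Omega>" "\<And>y. y \<in> closure \<Omega> \<Longrightarrow> u y \<le> u x"
    using continuous_attains_sup[OF _ _ u_cont] by blast
  obtain v where "v \<in> \<Omega>" using assms by blast
  then have "u x > 0" using x(2)[of v] u_pos[of v] closure_subset by fastforce
  then have "x \<notin> frontier \<Omega>" using u_frontier by force
  then have x\<Omega>: "x \<in> \<Omega>" using x(1) interior_open[OF open_dom] by (simp add: frontier_def)
  obtain r where r: "r > 0" "ball x r \<subseteq> \<Omega>" using open_dom x\<Omega> open_contains_ball by blast
  have "pd i u x = 0" for i
  proof -
    have d: "((\<lambda>t. u (x + t *\<^sub>R axis i 1)) has_real_derivative pd i u x) (at 0)"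
      using pd_line[where t = 0 and g = u and x = x and i = i] C2_onD(1)[OF u_C2 open_dom x\<Omega>] by simp
    have "u (x + t *\<^sub>R axis i 1) \<le> u (x + 0 *\<^sub>R axis i 1)" if "\<bar>0 - t\<bar> < r" for t
    proof -
      have "x + t *\<^sub>R axis i 1 \<in> ball x r" using that by (simp add: dist_norm)
      then show ?thesis using r x(2) closure_subset by fastforce
    qed
    then show ?thesis using DERIV_local_max[OF d r(1)] by blast
  qed
  then show thesis using that[OF x\<Omega>] x(2) closure_subset by (auto simp: critical_point_def subset_eq)
qed

end

text \<open>For i = k this is the symmetry in the hyperplane x_k = 0. For i different from k the
  reflection is an orthogonal map that fixes the x_k axis, so the rotational invariance covers
  it.\<close>

lemma simple_rot_sym_refl_at:
  assumes "simple_rot_sym k \<Omega>" "x \<in> \<Omega>"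
  shows "refl_at i 0 x \<in> \<Omega>"
proof (cases "i = k")
  case True
  have "refl_at i 0 x = (\<chi> j. if j = k then - (x$j) else x$j)" using True by (simp add: vec_eq_iff)
  then show ?thesis using assms unfolding simple_rot_sym_def by simp
next
  case False
  have "orthogonal_transformation (refl_at i 0 :: real^'a \<Rightarrow> real^'a)"
    unfolding orthogonal_transformation_def
  proof
    show "linear (refl_at i 0 :: real^'a \<Rightarrow> real^'a)"
      by (rule linearI) (auto simp: vec_eq_iff)
    show "\<forall>v w :: real^'a. refl_at i 0 v \<bullet> refl_at i 0 w = v \<bullet> w"
      unfolding inner_vec_def by (auto intro!: sum.cong)
  qed
  moreover have "refl_at i 0 (t *\<^sub>R axis k 1) = t *\<^sub>R axis k 1" for t
    using False by (simp add: vec_eq_iff axis_def)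
  ultimately have "refl_at i 0 ` \<Omega> = \<Omega>" using assms unfolding simple_rot_sym_def by blast
  then show ?thesis using assms(2) by blast
qed

theorem theorem1p3:
  fixes \<Omega> :: "(real^'n::finite) set" and k :: 'n
    and u :: "real^'n \<Rightarrow> real" and f f' :: "real \<Rightarrow> real"
  assumes "CARD('n) \<ge> 3"
    and "domain \<Omega>" and "bounded \<Omega>" and "simple_rot_sym k \<Omega>"
    and "\<And>t. (f has_real_derivative f' t) (at t)" and "continuous_on UNIV f'"
    and "convex_on UNIV f"
    and "C2_on \<Omega> u" and "continuous_on (closure \<Omega>) u"
    and "\<And>x. x \<in> \<Omega> \<Longrightarrow> - laplacian u x = f (u x)"
    and "\<And>x. x \<in> frontier \<Omega> \<Longrightarrow> u x = 0"
    and "\<And>x. x \<in> \<Omega> \<Longrightarrow> u x > 0"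
    and "stable \<Omega> f' u"
  shows "(\<exists>!x. x \<in> \<Omega> \<and> critical_point u x) \<and>
         (\<forall>x\<in>\<Omega>. critical_point u x \<longrightarrow> (\<forall>y\<in>\<Omega>. u y \<le> u x) \<and> det (hessian u x) \<noteq> 0)"
proof -
  have dom: "open \<Omega>" "\<Omega> \<noteq> {}" using assms(2) by (auto simp: domain_def)
  interpret stable_solution \<Omega> u f f'
    by unfold_locales (use assms dom simple_rot_sym_refl_at[OF assms(4)] in \<open>auto simp: simple_rot_sym_def\<close>)
  obtain x where x: "x \<in> \<Omega>" "\<And>y. y \<in> \<Omega> \<Longrightarrow> u y \<le> u x" "critical_point u x"
    using maximum_exists[OF dom(2)] by blast
  \<comment> \<open>This also yields that the origin belongs to \<Omega>: a maximum point exists and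
    can lie nowhere else.\<close>
  have x0: "x = 0" using critical_point_eq_0[OF x(1,3)] .
  have 0: "0 \<in> \<Omega>" using x(1) x0 by simp
  have "det (hessian u 0) = (\<Prod>i\<in>UNIV. hessian u 0 $ i $ i)"
    by (rule det_diagonal) (simp add: hessian_def hessian_off_diagonal[OF 0])
  also have "\<dots> \<noteq> 0"
    using hessian_diagonal_neg[OF 0] by (simp add: hessian_def less_imp_neq)
  finally have "det (hessian u 0) \<noteq> 0" .
  then show ?thesis using x x0 critical_point_eq_0 by blast
qed

end
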